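(* Let $\mu\le\lambda$ be infinite cardinals with $\mu$ regular, let $\mathcal{K}$ be a $(\mu,<\lambda)$-accessible category and let $\theta\ge\lambda$ be a weakly inaccessible cardinal. If $\theta$ is $\mu$-closed, then no object $M$ of $\mathcal{K}$ has presentability rank $r_{\mathcal{K}}(M)$ equal to $\theta$.
   Context: A weakly inaccessible cardinal is an uncountable regular limit cardinal. A cardinal $\theta\ge\mu$ is $\mu$-closed if $\chi^{<\mu}<\theta$ for all cardinals $\chi<\theta$. For a regular cardinal $\lambda$, a poset is $\lambda$-directed if each of its subsets of cardinality strictly less than $\lambda$ has an upper bound. An object $M$ of a category $\mathcal{K}$ is $\lambda$-presentable if $\mathcal{K}(M,-):\mathcal{K}\to\mathbf{Set}$ preserves $\lambda$-directed colimits. For an infinite cardinal $\lambda$, $M$ is $(<\lambda)$-presentable if it is $\lambda_0$-presentable for some regular $\lambda_0 < \lambda + \aleph_1$ (cardinal addition, i.e. the maximum). The presentability rank $r_{\mathcal{K}}(M)$ is the least regular cardinal $\lambda$ such that $M$ is $\lambda$-presentable. For infinite cardinals $\mu\le\lambda$ with $\mu$ regular, a category $\mathcal{K}$ is $(\mu,<\lambda)$-accessible if (1) it has $\mu$-directed colimits, (2) every object of $\mathcal{K}$ is the colimit of a $\mu$-directed system consisting of $(<\lambda)$-presentable objects, and (3) it has only a set, up to isomorphism, of $(<\lambda)$-presentable objects. *)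

theory Defs
  imports Main "HOL-Library.FuncSet"
begin

unbundle cardinal_syntax

text \<open>
  Set-theoretic framework. A type \<open>'u\<close> whose cardinality is strongly inaccessible plays the
  role of the universe of all sets: classes are the terms of type \<open>'u set\<close>, sets are the
  classes of cardinality strictly smaller than the universe, and the
  cardinals are represented, up to order isomorphism, by the cardinal well-orders
  of type \<open>'u rel\<close> that are strictly smaller than the universe. As usual for the cardinals of
  \<open>Main\<close>, equality of cardinals is \<open>=o\<close>.
\<close>

definition strongly_inaccessible :: "'a rel \<Rightarrow> bool" where
  "strongly_inaccessible \<kappa> \<longleftrightarrow>
     Card_order \<kappa> \<and> natLeq <o \<kappa> \<and> regularCard \<kappa> \<and>
     (\<forall>\<chi> :: 'a rel. Card_order \<chi> \<and> \<chi> <o \<kappa> \<longrightarrow> ctwo ^c \<chi> <o \<kappa>)"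

definition universe :: "'u itself \<Rightarrow> bool" where
  "universe _ \<longleftrightarrow> strongly_inaccessible |UNIV :: 'u set|"

definition small :: "'u set \<Rightarrow> bool" where
  "small X \<longleftrightarrow> |X| <o |UNIV :: 'u set|"

definition cardinal :: "'u rel \<Rightarrow> bool" where
  "cardinal \<kappa> \<longleftrightarrow> Card_order \<kappa> \<and> \<kappa> <o |UNIV :: 'u set|"

definition infinite_cardinal :: "'u rel \<Rightarrow> bool" where
  "infinite_cardinal \<kappa> \<longleftrightarrow> cardinal \<kappa> \<and> cinfinite \<kappa>"

definition regular_cardinal :: "'u rel \<Rightarrow> bool" where
  "regular_cardinal \<kappa> \<longleftrightarrow> infinite_cardinal \<kappa> \<and> regularCard \<kappa>"

definition limit_cardinal :: "'u rel \<Rightarrow> bool" where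
  "limit_cardinal \<kappa> \<longleftrightarrow> infinite_cardinal \<kappa> \<and>
     (\<forall>\<chi> :: 'u rel. cardinal \<chi> \<and> \<chi> <o \<kappa> \<longrightarrow> cardSuc \<chi> <o \<kappa>)"

definition weakly_inaccessible :: "'u rel \<Rightarrow> bool" where
  "weakly_inaccessible \<theta> \<longleftrightarrow>
     natLeq <o \<theta> \<and> regular_cardinal \<theta> \<and> limit_cardinal \<theta>"

text \<open>
  The weak power \<open>\<chi>\<close> to the \<open><\<mu>\<close> is the cardinality of the set of sequences in \<open>\<chi>\<close> of length
  strictly less than \<open>\<mu>\<close>. A length is a proper initial segment of the well-order \<open>\<mu>\<close>; the
  sequences are partial maps, so that those of different lengths are distinct.
\<close>

definition weak_power :: "'u rel \<Rightarrow> 'u rel \<Rightarrow> ('u \<rightharpoonup> 'u) rel" where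
  "weak_power \<chi> \<mu> =
     |{s. (\<exists>a\<in>Field \<mu>. dom s = underS \<mu> a) \<and> ran s \<subseteq> Field \<chi>}|"

definition closed_cardinal :: "'u rel \<Rightarrow> 'u rel \<Rightarrow> bool" where
  "closed_cardinal \<mu> \<theta> \<longleftrightarrow>
     cardinal \<theta> \<and> \<mu> \<le>o \<theta> \<and>
     (\<forall>\<chi> :: 'u rel. cardinal \<chi> \<and> \<chi> <o \<theta> \<longrightarrow> weak_power \<chi> \<mu> <o \<theta>)"

section \<open>Categories, functors and colimits\<close>

text \<open>\<open>Compose C g f\<close> is \<open>g\<close> after \<open>f\<close>.\<close>

record ('o, 'a) category =
  Obj :: "'o set"
  Arr :: "'a set"
  Dom :: "'a \<Rightarrow> 'o"
  Cod :: "'a \<Rightarrow> 'o"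
  Ident :: "'o \<Rightarrow> 'a"
  Compose :: "'a \<Rightarrow> 'a \<Rightarrow> 'a"

definition Hom :: "('o, 'a) category \<Rightarrow> 'o \<Rightarrow> 'o \<Rightarrow> 'a set" where
  "Hom C A B = {f \<in> Arr C. Dom C f = A \<and> Cod C f = B}"

locale category =
  fixes C :: "('o, 'a) category"
  assumes Dom_in_Obj: "f \<in> Arr C \<Longrightarrow> Dom C f \<in> Obj C"
    and Cod_in_Obj: "f \<in> Arr C \<Longrightarrow> Cod C f \<in> Obj C"
    and Ident_in_Hom: "A \<in> Obj C \<Longrightarrow> Ident C A \<in> Hom C A A"
    and Compose_in_Hom:
      "f \<in> Hom C A B \<Longrightarrow> g \<in> Hom C B D \<Longrightarrow> Compose C g f \<in> Hom C A D"
    and Compose_Ident_right: "f \<in> Hom C A B \<Longrightarrow> Compose C f (Ident C A) = f"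
    and Compose_Ident_left: "f \<in> Hom C A B \<Longrightarrow> Compose C (Ident C B) f = f"
    and Compose_assoc:
      "f \<in> Hom C A B \<Longrightarrow> g \<in> Hom C B D \<Longrightarrow> h \<in> Hom C D E \<Longrightarrow>
        Compose C h (Compose C g f) = Compose C (Compose C h g) f"

text \<open>
  The arrows of \<open>K\<close> live in the universe \<open>'u\<close>, so there is a class of them (hence also
  of objects), and each hom-class is required to be a set.
\<close>

definition locally_small :: "('o, 'u) category \<Rightarrow> bool" where
  "locally_small K \<longleftrightarrow> (\<forall>A\<in>Obj K. \<forall>B\<in>Obj K. small (Hom K A B))"

definition isomorphic :: "('o, 'a) category \<Rightarrow> 'o \<Rightarrow> 'o \<Rightarrow> bool" where
  "isomorphic C A B \<longleftrightarrow>
     (\<exists>f\<in>Hom C A B. \<exists>g\<in>Hom C B A.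
        Compose C g f = Ident C A \<and> Compose C f g = Ident C B)"

record ('o, 'a, 'p, 'b) functor_data =
  omap :: "'o \<Rightarrow> 'p"
  amap :: "'a \<Rightarrow> 'b"

definition is_functor ::
  "('o, 'a) category \<Rightarrow> ('p, 'b) category \<Rightarrow> ('o, 'a, 'p, 'b) functor_data \<Rightarrow> bool" where
  "is_functor C D F \<longleftrightarrow>
     (\<forall>A\<in>Obj C. omap F A \<in> Obj D) \<and>
     (\<forall>f\<in>Arr C. amap F f \<in> Hom D (omap F (Dom C f)) (omap F (Cod C f))) \<and>
     (\<forall>A\<in>Obj C. amap F (Ident C A) = Ident D (omap F A)) \<and>
     (\<forall>f\<in>Arr C. \<forall>g\<in>Arr C. Cod C f = Dom C g \<longrightarrow>
        amap F (Compose C g f) = Compose D (amap F g) (amap F f))"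

definition functor_comp ::
  "('p, 'b, 'q, 'c) functor_data \<Rightarrow> ('o, 'a, 'p, 'b) functor_data \<Rightarrow> ('o, 'a, 'q, 'c) functor_data"
  where "functor_comp G F = \<lparr>omap = omap G \<circ> omap F, amap = amap G \<circ> amap F\<rparr>"

definition is_cocone ::
  "('j, 'k) category \<Rightarrow> ('o, 'a) category \<Rightarrow> ('j, 'k, 'o, 'a) functor_data \<Rightarrow>
    'o \<Rightarrow> ('j \<Rightarrow> 'a) \<Rightarrow> bool" where
  "is_cocone J C D L \<iota> \<longleftrightarrow>
     L \<in> Obj C \<and>
     (\<forall>j\<in>Obj J. \<iota> j \<in> Hom C (omap D j) L) \<and>
     (\<forall>u\<in>Arr J. Compose C (\<iota> (Cod J u)) (amap D u) = \<iota> (Dom J u))"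

definition is_colimit ::
  "('j, 'k) category \<Rightarrow> ('o, 'a) category \<Rightarrow> ('j, 'k, 'o, 'a) functor_data \<Rightarrow>
    'o \<Rightarrow> ('j \<Rightarrow> 'a) \<Rightarrow> bool" where
  "is_colimit J C D L \<iota> \<longleftrightarrow>
     is_cocone J C D L \<iota> \<and>
     (\<forall>N \<nu>. is_cocone J C D N \<nu> \<longrightarrow>
        (\<exists>!h. h \<in> Hom C L N \<and> (\<forall>j\<in>Obj J. Compose C h (\<iota> j) = \<nu> j)))"

section \<open>The category of sets and representable functors\<close>

text \<open>A map is a triple consisting of its domain, an extensional function, and its codomain.\<close>

definition set_cat :: "('u set, 'u set \<times> ('u \<Rightarrow> 'u) \<times> 'u set) category" where
  "set_cat =
     \<lparr>Obj = {X. small X},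
      Arr = {(X, f, Y). small X \<and> small Y \<and> f \<in> X \<rightarrow>\<^sub>E Y},
      Dom = (\<lambda>(X, f, Y). X),
      Cod = (\<lambda>(X, f, Y). Y),
      Ident = (\<lambda>X. (X, restrict id X, X)),
      Compose = (\<lambda>(Y, g, Z) (X, f, Y'). (X, compose X g f, Z))\<rparr>"

definition hom_functor ::
  "('o, 'u) category \<Rightarrow> 'o \<Rightarrow> ('o, 'u, 'u set, 'u set \<times> ('u \<Rightarrow> 'u) \<times> 'u set) functor_data" where
  "hom_functor K M =
     \<lparr>omap = (\<lambda>A. Hom K M A),
      amap = (\<lambda>f. (Hom K M (Dom K f),
                   (\<lambda>x\<in>Hom K M (Dom K f). Compose K f x),
                   Hom K M (Cod K f)))\<rparr>"

lemma Hom_set_cat: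
  "Hom set_cat X Y = {(X', f, Y'). X' = X \<and> Y' = Y \<and> small X \<and> small Y \<and> f \<in> X \<rightarrow>\<^sub>E Y}"
  by (auto simp: Hom_def set_cat_def)

lemma category_set_cat: "category set_cat"
  by unfold_locales
    (auto simp: set_cat_def Hom_def compose_def restrict_def PiE_def Pi_def extensional_def
      fun_eq_iff)

lemma is_functor_hom_functor:
  assumes "category K" "locally_small K" "M \<in> Obj K"
  shows "is_functor K set_cat (hom_functor K M)"
proof -
  interpret category K by fact
  have in_Hom: "f \<in> Hom K (Dom K f) (Cod K f)" if "f \<in> Arr K" for f
    using that by (simp add: Hom_def)
  have closed: "Compose K f x \<in> Hom K M (Cod K f)"
    if "f \<in> Arr K" "x \<in> Hom K M (Dom K f)" for f x
    using Compose_in_Hom in_Hom that by blast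
  have small: "small (Hom K M A)" if "A \<in> Obj K" for A
    using assms that by (simp add: locally_small_def)
  have ident: "Dom K (Ident K A) = A" "Cod K (Ident K A) = A" if "A \<in> Obj K" for A
    using Ident_in_Hom[OF that] by (simp_all add: Hom_def)
  have comp: "Dom K (Compose K g f) = Dom K f" "Cod K (Compose K g f) = Cod K g"
    if "f \<in> Arr K" "g \<in> Arr K" "Cod K f = Dom K g" for f g
    using Compose_in_Hom[of f "Dom K f" "Cod K f" g "Cod K g"] that by (auto simp: Hom_def)
  have assoc: "Compose K (Compose K g f) x = Compose K g (Compose K f x)"
    if "f \<in> Arr K" "g \<in> Arr K" "Cod K f = Dom K g" "x \<in> Hom K M (Dom K f)" for f g x
    using Compose_assoc[of x M "Dom K f" f "Cod K f" g "Cod K g"] that by (simp add: Hom_def)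
  show ?thesis
    unfolding is_functor_def
  proof (intro conjI ballI impI)
    fix A assume "A \<in> Obj K"
    then show "omap (hom_functor K M) A \<in> Obj set_cat"
      by (simp add: hom_functor_def set_cat_def small)
    from \<open>A \<in> Obj K\<close>
    show "amap (hom_functor K M) (Ident K A) = Ident set_cat (omap (hom_functor K M) A)"
      by (auto simp: hom_functor_def set_cat_def ident Compose_Ident_left fun_eq_iff restrict_def)
  next
    fix f assume "f \<in> Arr K"
    then show "amap (hom_functor K M) f \<in>
        Hom set_cat (omap (hom_functor K M) (Dom K f)) (omap (hom_functor K M) (Cod K f))"
      using closed
      by (simp add: hom_functor_def Hom_set_cat small Dom_in_Obj Cod_in_Obj)
  next
    fix f g assume "f \<in> Arr K" "g \<in> Arr K" "Cod K f = Dom K g"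
    then show "amap (hom_functor K M) (Compose K g f) =
        Compose set_cat (amap (hom_functor K M) g) (amap (hom_functor K M) f)"
      using closed[of f]
      by (auto simp: hom_functor_def set_cat_def comp assoc fun_eq_iff restrict_def compose_def)
  qed
qed

section \<open>Directed colimits, presentability and accessibility\<close>

text \<open>A poset is a relation \<open>R\<close> that is a partial order on its field.\<close>

definition directed :: "'u rel \<Rightarrow> 'u rel \<Rightarrow> bool" where
  "directed \<kappa> R \<longleftrightarrow>
     Partial_order R \<and>
     (\<forall>X \<subseteq> Field R. |X| <o \<kappa> \<longrightarrow> (\<exists>b\<in>Field R. \<forall>x\<in>X. (x, b) \<in> R))"

definition poset_cat :: "'u rel \<Rightarrow> ('u, 'u \<times> 'u) category" where
  "poset_cat R =
     \<lparr>Obj = Field R, Arr = R, Dom = fst, Cod = snd,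
      Ident = (\<lambda>x. (x, x)), Compose = (\<lambda>(y, z) (x, y'). (x, z))\<rparr>"

lemma category_poset_cat:
  assumes "Partial_order R"
  shows "category (poset_cat R)"
  using assms
  by unfold_locales
    (auto simp: poset_cat_def Hom_def partial_order_on_def preorder_on_def refl_on_def
      Field_def intro: transD)

type_synonym ('o, 'u) system = "('u, 'u \<times> 'u, 'o, 'u) functor_data"

definition directed_system ::
  "'u rel \<Rightarrow> ('o, 'u) category \<Rightarrow> 'u rel \<Rightarrow> ('o, 'u) system \<Rightarrow> bool" where
  "directed_system \<kappa> K R D \<longleftrightarrow>
     small (Field R) \<and> directed \<kappa> R \<and> is_functor (poset_cat R) K D"

definition has_directed_colimits :: "'u rel \<Rightarrow> ('o, 'u) category \<Rightarrow> bool" where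
  "has_directed_colimits \<kappa> K \<longleftrightarrow>
     (\<forall>R D. directed_system \<kappa> K R D \<longrightarrow> (\<exists>L \<iota>. is_colimit (poset_cat R) K D L \<iota>))"

definition preserves_directed_colimits ::
  "'u rel \<Rightarrow> ('o, 'u) category \<Rightarrow> ('p, 'b) category \<Rightarrow> ('o, 'u, 'p, 'b) functor_data \<Rightarrow> bool" where
  "preserves_directed_colimits \<kappa> K C F \<longleftrightarrow>
     (\<forall>R D L \<iota>. directed_system \<kappa> K R D \<and> is_colimit (poset_cat R) K D L \<iota> \<longrightarrow>
        is_colimit (poset_cat R) C (functor_comp F D) (omap F L) (amap F \<circ> \<iota>))"

definition presentable :: "('o, 'u) category \<Rightarrow> 'u rel \<Rightarrow> 'o \<Rightarrow> bool" where
  "presentable K \<kappa> M \<longleftrightarrow>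
     M \<in> Obj K \<and> preserves_directed_colimits \<kappa> K set_cat (hom_functor K M)"

definition less_presentable :: "('o, 'u) category \<Rightarrow> 'u rel \<Rightarrow> 'o \<Rightarrow> bool" where
  "less_presentable K \<kappa> M \<longleftrightarrow>
     (\<exists>\<kappa>\<^sub>0 :: 'u rel.
        regular_cardinal \<kappa>\<^sub>0 \<and> \<kappa>\<^sub>0 <o \<kappa> +c cardSuc natLeq \<and> presentable K \<kappa>\<^sub>0 M)"

text \<open>
  The rank is given as a relation: a general object need not be presentable for any cardinal,
  and the rank is determined only up to \<open>=o\<close>.
\<close>

definition has_presentability_rank :: "('o, 'u) category \<Rightarrow> 'o \<Rightarrow> 'u rel \<Rightarrow> bool" where
  "has_presentability_rank K M \<kappa> \<longleftrightarrow>
     regular_cardinal \<kappa> \<and> presentable K \<kappa> M \<and>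
     (\<forall>\<kappa>' :: 'u rel. regular_cardinal \<kappa>' \<and> presentable K \<kappa>' M \<longrightarrow> \<kappa> \<le>o \<kappa>')"

definition accessible :: "'u rel \<Rightarrow> 'u rel \<Rightarrow> ('o, 'u) category \<Rightarrow> bool" where
  "accessible \<mu> \<kappa> K \<longleftrightarrow>
     category K \<and> locally_small K \<and>
     has_directed_colimits \<mu> K \<and>
     (\<forall>M\<in>Obj K. \<exists>R D \<iota>.
        directed_system \<mu> K R D \<and>
        (\<forall>i\<in>Field R. less_presentable K \<kappa> (omap D i)) \<and>
        is_colimit (poset_cat R) K D M \<iota>) \<and>
     (\<exists>S \<subseteq> Obj K. |S| <o |UNIV :: 'u set| \<and>
        (\<forall>M\<in>Obj K. less_presentable K \<kappa> M \<longrightarrow> (\<exists>N\<in>S. isomorphic K M N)))"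

end

theory Submission
  imports Defs
begin

text \<open>
  Suppose \<open>M\<close> is \<open>\<theta>\<close>-presentable. Write \<open>M\<close> as the colimit of a \<open>\<mu>\<close>-directed system of
  \<open>(<\<lambda>)\<close>-presentable objects over \<open>R\<close>. Since \<open>\<theta>\<close> is \<open>\<mu>\<close>-closed, the \<open>\<mu>\<close>-directed subsets of
  \<open>R\<close> of size \<open><\<theta>\<close> are cofinal among all subsets of size \<open><\<theta>\<close>, so the colimits of the
  corresponding subsystems form a \<open>\<theta>\<close>-directed system with colimit \<open>M\<close>. The identity of \<open>M\<close>
  then factors through one of them: \<open>M\<close> is a retract of a colimit of fewer than \<open>\<theta>\<close> objects,
  each presentable for some regular cardinal below \<open>\<theta>\<close>. As \<open>\<theta>\<close> is a regular limit cardinal,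
  the successor of the supremum of these cardinals and of the size of the subsystem is a regular
  cardinal below \<open>\<theta>\<close> for which \<open>M\<close> is presentable.
\<close>

section \<open>Cardinals\<close>

lemma regular_cardinalD:
  assumes "regular_cardinal \<kappa>"
  shows "Card_order \<kappa>" "\<not> finite (Field \<kappa>)" "regularCard \<kappa>" "Well_order \<kappa>"
    "Cinfinite \<kappa>" "natLeq \<le>o \<kappa>" "stable \<kappa>"
  using assms regularCard_stable[of \<kappa>]
  by (auto simp: regular_cardinal_def infinite_cardinal_def cardinal_def cinfinite_def
      natLeq_ordLeq_cinfinite card_order_on_well_order_on)

lemma cardinal_below:
  fixes \<chi> \<theta> :: "'u rel"
  assumes "cardinal \<theta>" "Card_order \<chi>" "\<chi> <o \<theta>"
  shows "cardinal \<chi>"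
  unfolding cardinal_def
  using assms(2) ordLess_transitive[OF assms(3)] assms(1) unfolding cardinal_def by blast

lemma regular_cardinal_cardinal: "regular_cardinal \<kappa> \<Longrightarrow> cardinal \<kappa>"
  by (simp add: regular_cardinal_def infinite_cardinal_def)

lemma finite_ordLess_regular:
  assumes "regular_cardinal \<kappa>" "finite X"
  shows "|X| <o \<kappa>"
  by (rule finite_ordLess_infinite)
    (use assms regular_cardinalD[OF assms(1)] in \<open>simp_all add: card_of_well_order_on Field_card_of\<close>)

lemma regular_UN:
  assumes "regular_cardinal \<kappa>" "|I| <o \<kappa>" "\<And>i. i \<in> I \<Longrightarrow> |F i| <o \<kappa>"
  shows "|\<Union>i\<in>I. F i| <o \<kappa>"
  using stable_UNION[of \<kappa> I F] assms regular_cardinalD(7) by blast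

lemma regular_Un:
  assumes "regular_cardinal \<kappa>" "|A| <o \<kappa>" "|B| <o \<kappa>"
  shows "|A \<union> B| <o \<kappa>"
  using card_of_Un_ordLess_infinite_Field regular_cardinalD[OF assms(1)] assms by blast

text \<open>\<open>cardSuc\<close> produces cardinals on another type, while regular cardinals are
  to be relations on \<open>'u\<close>. A cardinal strictly below \<open>\<theta>\<close> has an
  isomorphic copy inside the field of \<open>\<theta>\<close>, and regularity is invariant under
  \<open>=o\<close>.\<close>

lemma regular_cardinal_copy:
  fixes \<theta> :: "'u rel" and \<kappa> :: "'a rel"
  assumes "regular_cardinal \<theta>" "Cinfinite \<kappa>" "regularCard \<kappa>" "\<kappa> <o \<theta>"
  obtains \<kappa>' :: "'u rel" where "regular_cardinal \<kappa>'" "\<kappa>' =o \<kappa>"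
proof -
  obtain p :: "'u rel" where p: "\<kappa> =o p" "p <o \<theta>"
    using internalize_ordLess[of \<kappa> \<theta>] assms(4) by blast
  have "Cinfinite p" using Cinfinite_cong[OF p(1) assms(2)] .
  moreover have "regularCard p" using regularCard_ordIso[OF p(1) assms(2,3)] .
  moreover have "cardinal p"
    using cardinal_below[OF regular_cardinal_cardinal[OF assms(1)] _ p(2)] \<open>Cinfinite p\<close> by simp
  ultimately have "regular_cardinal p"
    by (simp add: regular_cardinal_def infinite_cardinal_def)
  then show ?thesis using that ordIso_symmetric[OF p(1)] by blast
qed

text \<open>A set smaller than \<open>\<mu>\<close> can be enumerated along a proper initial segment
  of \<open>\<mu>\<close>, so it is the range of one of the sequences counted by
  \<open>weak_power\<close>.\<close>

lemma small_subsets_weak_power: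
  assumes \<mu>: "Card_order \<mu>"
  shows "|{Z. Z \<subseteq> Y \<and> |Z| <o \<mu>}| \<le>o weak_power |Y| \<mu>"
proof -
  let ?S = "{s. (\<exists>a\<in>Field \<mu>. dom s = underS \<mu> a) \<and> ran s \<subseteq> Field |Y|}"
  have "{Z. Z \<subseteq> Y \<and> |Z| <o \<mu>} \<subseteq> ran ` ?S"
  proof clarify
    fix Z assume Z: "Z \<subseteq> Y" "|Z| <o \<mu>"
    have W: "Well_order \<mu>" using \<mu> by (simp add: card_order_on_well_order_on)
    then obtain a where a: "a \<in> Field \<mu>" "|Z| =o Restr \<mu> (underS \<mu> a)"
      using Z(2) ordLess_iff_ordIso_Restr[OF W card_of_Well_order] by blast
    have F: "Field (Restr \<mu> (underS \<mu> a)) = underS \<mu> a"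
      using W Field_Restr_ofilter[OF W] wo_rel.underS_ofilter[of \<mu> a] by (simp add: wo_rel_def)
    obtain f where "iso |Z| (Restr \<mu> (underS \<mu> a)) f" using a(2) unfolding ordIso_def by auto
    then have "bij_betw f Z (underS \<mu> a)" by (simp add: iso_def F Field_card_of)
    then obtain g where g: "bij_betw g (underS \<mu> a) Z" using bij_betw_inv by blast
    let ?s = "\<lambda>x. if x \<in> underS \<mu> a then Some (g x) else None"
    have "dom ?s = underS \<mu> a" by (auto split: if_splits)
    moreover have "ran ?s = Z" using g unfolding bij_betw_def ran_def by (auto split: if_splits)
    ultimately show "Z \<in> ran ` ?S" using a(1) Z(1)
      by (intro image_eqI[of _ _ ?s]) (auto simp: Field_card_of)
  qed
  then show ?thesis unfolding weak_power_def by (rule surj_imp_ordLeq)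
qed

text \<open>Already \<open>1\<close> to the \<open><\<mu>\<close> has at least \<open>\<mu>\<close> elements, one sequence for each length.\<close>

lemma closed_cardinal_less:
  fixes \<mu> \<theta> :: "'u rel"
  assumes \<mu>: "regular_cardinal \<mu>" and \<theta>: "regular_cardinal \<theta>" and cl: "closed_cardinal \<mu> \<theta>"
  shows "\<mu> <o \<theta>"
proof -
  note M = regular_cardinalD[OF \<mu>]
  \<comment> \<open>An arbitrary element, so that \<open>|{x}|\<close> can serve as the cardinal 1
    on \<open>'u\<close>.\<close>
  obtain x :: 'u where True by simp
  let ?S = "{s. (\<exists>a\<in>Field \<mu>. dom s = underS \<mu> a) \<and> ran s \<subseteq> Field |{x}|}"
  have T: "|{x}| <o \<theta>" by (rule finite_ordLess_regular[OF \<theta>]) simp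
  have "cardinal |{x}|"
    using cardinal_below[OF regular_cardinal_cardinal[OF \<theta>] card_of_Card_order T] .
  then have wp: "weak_power |{x}| \<mu> <o \<theta>" using cl T by (simp add: closed_cardinal_def)
  \<comment> \<open>The constant sequence of length \<open>underS \<mu> a\<close>. Different
    \<open>a\<close> give different sequences, because \<open>a\<close> can be recovered from
    \<open>underS \<mu> a\<close>.\<close>
  let ?f = "\<lambda>a b. if b \<in> underS \<mu> a then Some x else None"
  have dom: "dom (?f a) = underS \<mu> a" for a by (auto split: if_splits)
  have inj: "inj_on ?f (Field \<mu>)"
  proof (rule inj_onI)
    fix a b assume ab: "a \<in> Field \<mu>" "b \<in> Field \<mu>" "?f a = ?f b"
    then have u: "underS \<mu> a = underS \<mu> b" using dom[of a] dom[of b] by metis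
    show "a = b"
    proof (rule ccontr)
      assume "a \<noteq> b"
      then have "a \<in> underS \<mu> b \<or> b \<in> underS \<mu> a"
        using ab M(4) unfolding underS_def
        by (auto simp: well_order_on_def linear_order_on_def total_on_def)
      then show False using u by (auto simp: underS_def)
    qed
  qed
  have "ran (?f a) \<subseteq> Field |{x}|" for a by (auto simp: ran_def Field_card_of split: if_splits)
  then have "?f ` Field \<mu> \<subseteq> ?S" using dom by blast
  then have "|Field \<mu>| \<le>o |?S|" using inj card_of_ordLeq by blast
  then have "\<mu> \<le>o weak_power |{x}| \<mu>"
    unfolding weak_power_def
    using ordIso_ordLeq_trans[OF ordIso_symmetric[OF card_of_Field_ordIso[OF M(1)]]] by blast
  then show ?thesis using wp by (rule ordLeq_ordLess_trans)
qed

text \<open>The successor of an infinite cardinal is regular, and it stays below the limit cardinal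
  \<open>\<theta>\<close>. A countable set is adjoined to \<open>B\<close> to make the cardinal
  infinite; the result is still below \<open>\<theta>\<close>, which is uncountable.\<close>

lemma regular_successor_below:
  fixes \<theta> :: "'u rel"
  assumes \<theta>: "weakly_inaccessible \<theta>" and B: "|B :: 'u set| <o \<theta>"
  obtains \<kappa> :: "'u rel" where "regular_cardinal \<kappa>" "\<kappa> <o \<theta>" "|B| <o \<kappa>"
proof -
  have reg: "regular_cardinal \<theta>" using \<theta> by (simp add: weakly_inaccessible_def)
  obtain N :: "'u set" where N: "|N| =o natLeq"
  proof -
    have "natLeq <o \<theta>" using \<theta> by (simp add: weakly_inaccessible_def)
    then have "|UNIV :: nat set| <o \<theta>" using ordIso_ordLess_trans[OF card_of_nat] by blast
    then obtain N where "|UNIV :: nat set| =o |N :: 'u set|"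
      using internalize_card_of_ordLess[of "UNIV :: nat set" \<theta>] by blast
    then show ?thesis using that ordIso_transitive[OF ordIso_symmetric card_of_nat] by blast
  qed
  let ?B = "N \<union> B"
  have lt: "|?B| <o \<theta>"
    using regular_Un[OF reg _ B] ordIso_ordLess_trans[OF N] \<theta>
    unfolding weakly_inaccessible_def by blast
  have "cardinal |?B|"
    using cardinal_below[OF regular_cardinal_cardinal[OF reg] card_of_Card_order lt] .
  then have suc: "cardSuc |?B| <o \<theta>"
    using \<theta> lt by (auto simp: weakly_inaccessible_def limit_cardinal_def)
  have "natLeq \<le>o |?B|"
    using N card_of_mono1[of N ?B] ordIso_ordLeq_trans ordIso_symmetric by blast
  then have inf: "Cinfinite |?B|"
    by (metis card_of_Card_order cinfinite_mono natLeq_cinfinite)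
  obtain \<kappa> :: "'u rel" where k: "regular_cardinal \<kappa>" "\<kappa> =o cardSuc |?B|"
    using regular_cardinal_copy[OF reg Cinfinite_cardSuc[OF inf] regularCard_cardSuc[OF inf] suc]
    by blast
  have "|B| \<le>o |?B|" by (simp add: card_of_mono1)
  then have "|B| <o \<kappa>"
    using ordLess_ordIso_trans[OF ordLeq_ordLess_trans[OF _ cardSuc_greater] ordIso_symmetric[OF k(2)]]
      card_of_Card_order by blast
  then show ?thesis using that k(1) ordIso_ordLess_trans[OF k(2) suc] by blast
qed

text \<open>By regularity of \<open>\<theta>\<close>, the union of \<open>A\<close> with all the
  fields has size below \<open>\<theta>\<close>. It replaces the supremum of the
  \<open>\<kappa> i\<close>: a regular cardinal above it bounds each of them and the size of
  \<open>A\<close>.\<close>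

lemma bounded_regular_below:
  fixes \<theta> :: "'u rel" and \<kappa> :: "'u \<Rightarrow> 'u rel"
  assumes \<theta>: "weakly_inaccessible \<theta>" and A: "|A| <o \<theta>"
    and \<kappa>: "\<And>i. i \<in> A \<Longrightarrow> Card_order (\<kappa> i) \<and> \<kappa> i <o \<theta>"
  obtains \<nu> :: "'u rel" where "regular_cardinal \<nu>" "\<nu> <o \<theta>" "|A| <o \<nu>"
    "\<And>i. i \<in> A \<Longrightarrow> \<kappa> i \<le>o \<nu>"
proof -
  have reg: "regular_cardinal \<theta>" using \<theta> by (simp add: weakly_inaccessible_def)
  let ?B = "A \<union> (\<Union>i\<in>A. Field (\<kappa> i))"
  have "|Field (\<kappa> i)| <o \<theta>" if "i \<in> A" for i
    using \<kappa>[OF that] ordIso_ordLess_trans[OF card_of_Field_ordIso] by blast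
  then have "|?B| <o \<theta>" by (intro regular_Un[OF reg A] regular_UN[OF reg A])
  then obtain \<nu> :: "'u rel" where n: "regular_cardinal \<nu>" "\<nu> <o \<theta>" "|?B| <o \<nu>"
    using regular_successor_below[OF \<theta>] by blast
  have "\<kappa> i \<le>o \<nu>" if "i \<in> A" for i
  proof -
    have "|Field (\<kappa> i)| \<le>o |?B|" using that by (intro card_of_mono1) blast
    then have "|Field (\<kappa> i)| \<le>o \<nu>" using ordLess_imp_ordLeq[OF ordLeq_ordLess_trans[OF _ n(3)]] by blast
    then show ?thesis
      using ordIso_ordLeq_trans[OF ordIso_symmetric[OF card_of_Field_ordIso]] \<kappa>[OF that] by blast
  qed
  moreover have "|A| <o \<nu>" using ordLeq_ordLess_trans[OF card_of_mono1 n(3)] by simp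
  ultimately show ?thesis using that n by blast
qed

text \<open>The universe is a strong limit, so subsets of a small set can be coded by elements of
  \<open>'u\<close>. Families of subsets can then index diagrams, whose posets are relations on
  \<open>'u\<close>.\<close>

lemma inj_on_Pow_small:
  fixes X :: "'u set"
  assumes "universe TYPE('u)" "small X"
  obtains e :: "'u set \<Rightarrow> 'u" where "inj_on e (Pow X)" "small (e ` Pow X)"
proof -
  have "ctwo ^c |X| <o |UNIV :: 'u set|"
    using assms card_of_Card_order unfolding universe_def strongly_inaccessible_def small_def
    by blast
  moreover have "|Pow X| =o ctwo ^c |X|"
    using card_of_Pow_Func[of X] by (simp add: cexp_def ctwo_def Field_card_of)
  ultimately have lt: "|Pow X| <o |UNIV :: 'u set|" by (rule ordIso_ordLess_trans[rotated])
  then obtain e :: "'u set \<Rightarrow> 'u" where "inj_on e (Pow X)"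
    using card_of_ordLeq[of "Pow X" "UNIV :: 'u set"] ordLess_imp_ordLeq[OF lt] by blast
  then show ?thesis
    using that ordLeq_ordLess_trans[OF card_of_image lt] unfolding small_def by blast
qed

section \<open>Directed subsets\<close>

lemma Field_Restr_subset:
  assumes "Partial_order R" "A \<subseteq> Field R"
  shows "Field (Restr R A) = A"
  using assms by (auto simp: partial_order_on_def preorder_on_def refl_on_def Field_def)

lemma Partial_order_Restr:
  assumes "Partial_order R"
  shows "Partial_order (Restr R A)"
  using assms Refl_Restr[of R A] trans_Restr[of R A] antisym_Restr[of R A]
  by (auto simp: partial_order_on_def preorder_on_def intro: FieldI1 FieldI2)

text \<open>The closure is reached after \<open>\<mu>\<close> steps by regularity of \<open>\<mu>\<close>, and each step preserves being
  of size \<open><\<theta>\<close> as \<open>\<theta>\<close> is \<open>\<mu>\<close>-closed.\<close>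

lemma directed_closure:
  fixes \<mu> \<theta> R :: "'u rel"
  assumes \<mu>: "regular_cardinal \<mu>" and \<theta>: "regular_cardinal \<theta>" and cl: "closed_cardinal \<mu> \<theta>"
    and R: "directed \<mu> R" and X: "X \<subseteq> Field R" "|X| <o \<theta>"
  obtains A where "X \<subseteq> A" "A \<subseteq> Field R" "|A| <o \<theta>" "directed \<mu> (Restr R A)"
proof -
  note M = regular_cardinalD[OF \<mu>] and T = regular_cardinalD[OF \<theta>]
  have po: "Partial_order R" using R by (simp add: directed_def)
  have wo: "wo_rel \<mu>" using M by (simp add: wo_rel_def)
  \<comment> \<open>A chosen upper bound, meaningful only for subsets of \<open>Field R\<close>
    smaller than \<open>\<mu>\<close>.\<close>
  define ub where "ub Z = (SOME b. b \<in> Field R \<and> (\<forall>x\<in>Z. (x, b) \<in> R))" for Z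
  have ub: "ub Z \<in> Field R \<and> (\<forall>x\<in>Z. (x, ub Z) \<in> R)" if "Z \<subseteq> Field R" "|Z| <o \<mu>" for Z
    unfolding ub_def
    by (rule someI_ex[of "\<lambda>b. b \<in> Field R \<and> (\<forall>x\<in>Z. (x, b) \<in> R)"])
      (use R that in \<open>unfold directed_def, blast\<close>)
  define step where "step Y = X \<union> ub ` {Z. Z \<subseteq> Y \<and> |Z| <o \<mu>}" for Y
  \<comment> \<open>Transfinite recursion along \<open>\<mu>\<close>: each stage adjoins to
    \<open>X\<close> the chosen bounds of all subsets of size below \<open>\<mu>\<close> of the
    union of the earlier stages.\<close>
  define F where "F = wo_rel.worec \<mu> (\<lambda>f a. step (\<Union>b\<in>underS \<mu> a. f b))"
  \<comment> \<open>The value at \<open>a\<close> depends only on the values strictly below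
    \<open>a\<close>, which licenses unfolding the recursion.\<close>
  have "wo_rel.adm_wo \<mu> (\<lambda>f a. step (\<Union>b\<in>underS \<mu> a. f b))"
    unfolding wo_rel.adm_wo_def[OF wo]
  proof (intro allI impI)
    fix f g :: "'u \<Rightarrow> 'u set" and a assume "\<forall>b\<in>underS \<mu> a. f b = g b"
    then have "(\<Union>b\<in>underS \<mu> a. f b) = (\<Union>b\<in>underS \<mu> a. g b)" by simp
    then show "step (\<Union>b\<in>underS \<mu> a. f b) = step (\<Union>b\<in>underS \<mu> a. g b)" by (rule arg_cong)
  qed
  then have F: "F a = step (\<Union>b\<in>underS \<mu> a. F b)" for a
    unfolding F_def by (rule fun_cong[OF wo_rel.worec_fixpoint[OF wo]])
  have FR: "F a \<subseteq> Field R \<and> |F a| <o \<theta>" if "a \<in> Field \<mu>" for a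
    using that
  proof (induction a rule: wo_rel.well_order_induct[OF wo])
    case (1 a)
    let ?Y = "\<Union>b\<in>underS \<mu> a. F b"
    have IH: "F b \<subseteq> Field R \<and> |F b| <o \<theta>" if "b \<in> underS \<mu> a" for b
      using that 1 by (auto simp: underS_def Field_def)
    \<comment> \<open>There are fewer than \<open>\<mu>\<close>, hence fewer than
      \<open>\<theta>\<close>, earlier stages. Regularity of \<open>\<theta>\<close> bounds their
      union, and closedness bounds the number of subsets of size below \<open>\<mu>\<close> in that
      union.\<close>
    have "|underS \<mu> a| <o \<mu>" using card_of_underS[OF M(1)] 1 by simp
    then have "|underS \<mu> a| <o \<theta>"
      using ordLess_transitive[OF _ closed_cardinal_less[OF \<mu> \<theta> cl]] by blast
    then have Y: "|?Y| <o \<theta>" using regular_UN[OF \<theta>, of "underS \<mu> a" F] IH by blast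
    then have "cardinal |?Y|"
      using cardinal_below[OF regular_cardinal_cardinal[OF \<theta>] card_of_Card_order] by blast
    then have "weak_power |?Y| \<mu> <o \<theta>" using cl Y by (simp add: closed_cardinal_def)
    then have "|ub ` {Z. Z \<subseteq> ?Y \<and> |Z| <o \<mu>}| <o \<theta>"
      using ordLeq_ordLess_trans[OF ordLeq_transitive[OF card_of_image small_subsets_weak_power[OF M(1)]]]
      by blast
    then have "|F a| <o \<theta>" unfolding F[of a] step_def by (rule regular_Un[OF \<theta> X(2)])
    moreover have "?Y \<subseteq> Field R" using IH by blast
    then have "F a \<subseteq> Field R" unfolding F[of a] step_def using X(1) ub by blast
    ultimately show ?case by blast
  qed
  let ?A = "\<Union>a\<in>Field \<mu>. F a"
  have AR: "?A \<subseteq> Field R" using FR by blast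
  have "|Field \<mu>| <o \<theta>"
    using ordIso_ordLess_trans[OF card_of_Field_ordIso[OF M(1)] closed_cardinal_less[OF \<mu> \<theta> cl]] .
  then have card: "|?A| <o \<theta>" using regular_UN[OF \<theta>, of "Field \<mu>" F] FR by blast
  have "Field \<mu> \<noteq> {}" using M(2) by auto
  then have "X \<subseteq> ?A" using F unfolding step_def by blast
  moreover have "directed \<mu> (Restr R ?A)"
    unfolding directed_def Field_Restr_subset[OF po AR]
  proof (intro conjI allI impI Partial_order_Restr[OF po, of ?A, unfolded Field_Restr_subset[OF po AR]])
    fix Z assume Z: "Z \<subseteq> ?A" "|Z| <o \<mu>"
    \<comment> \<open>Although \<open>step Y\<close> need not contain \<open>Y\<close>, the stages
      increase, because \<open>step\<close> is monotone and later stages start from larger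
      unions.\<close>
    have chain: "relChain \<mu> F"
      unfolding relChain_def
    proof (intro allI impI)
      fix a b assume "(a, b) \<in> \<mu>"
      then have "underS \<mu> a \<subseteq> underS \<mu> b"
        using M(4) underS_incr[of \<mu> a b]
        by (auto simp: well_order_on_def linear_order_on_def partial_order_on_def preorder_on_def)
      then show "F a \<subseteq> F b" unfolding F[of a] F[of b] step_def by blast
    qed
    \<comment> \<open>Regularity of \<open>\<mu>\<close> puts \<open>Z\<close> into a single stage
      \<open>a\<close>. As \<open>\<mu>\<close> has no last element, there is a later stage
      \<open>b\<close>, and it contains the bound chosen for \<open>Z\<close>.\<close>
    obtain a where a: "a \<in> Field \<mu>" "Z \<subseteq> F a"
      using regularCard_UNION[OF M(1,3) chain Z] by blast
    obtain b where b: "b \<in> Field \<mu>" "a \<noteq> b" "(a, b) \<in> \<mu>"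
      using infinite_Card_order_limit[OF M(1,2) a(1)] by blast
    then have "Z \<subseteq> (\<Union>b\<in>underS \<mu> b. F b)" using a by (auto simp: underS_def)
    then have "ub Z \<in> F b" unfolding F[of b] step_def using Z(2) by blast
    then show "\<exists>b\<in>?A. \<forall>x\<in>Z. (x, b) \<in> Restr R ?A"
      using b(1) ub[of Z] Z AR by (intro bexI[of _ "ub Z"]) auto
  qed
  ultimately show ?thesis using that AR card by blast
qed

section \<open>Systems indexed by posets\<close>

lemma is_functor_poset_cat_iff:
  assumes "Partial_order R"
  shows "is_functor (poset_cat R) C D \<longleftrightarrow>
     (\<forall>i\<in>Field R. omap D i \<in> Obj C) \<and>
     (\<forall>i j. (i, j) \<in> R \<longrightarrow> amap D (i, j) \<in> Hom C (omap D i) (omap D j)) \<and>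
     (\<forall>i\<in>Field R. amap D (i, i) = Ident C (omap D i)) \<and>
     (\<forall>i j k. (i, j) \<in> R \<longrightarrow> (j, k) \<in> R \<longrightarrow>
        amap D (i, k) = Compose C (amap D (j, k)) (amap D (i, j)))"
  unfolding is_functor_def poset_cat_def by fastforce

lemma is_cocone_poset_cat_iff:
  "is_cocone (poset_cat R) C D L \<iota> \<longleftrightarrow>
     L \<in> Obj C \<and> (\<forall>j\<in>Field R. \<iota> j \<in> Hom C (omap D j) L) \<and>
     (\<forall>i j. (i, j) \<in> R \<longrightarrow> Compose C (\<iota> j) (amap D (i, j)) = \<iota> i)"
  unfolding is_cocone_def poset_cat_def by fastforce

lemma Obj_poset_cat [simp]: "Obj (poset_cat R) = Field R"
  by (simp add: poset_cat_def)

lemma is_colimitD_cocone: "is_colimit J C D L \<iota> \<Longrightarrow> is_cocone J C D L \<iota>"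
  by (simp add: is_colimit_def)

lemma Partial_order_refl: "Partial_order R \<Longrightarrow> i \<in> Field R \<Longrightarrow> (i, i) \<in> R"
  by (auto simp: partial_order_on_def preorder_on_def refl_on_def)

lemma directed_bound:
  assumes "directed \<kappa> R" "|I| <o \<kappa>" "\<And>i. i \<in> I \<Longrightarrow> f i \<in> Field R"
  obtains b where "b \<in> Field R" "\<And>i. i \<in> I \<Longrightarrow> (f i, b) \<in> R"
proof -
  have "|f ` I| <o \<kappa>" using ordLeq_ordLess_trans[OF card_of_image assms(2)] .
  moreover have "f ` I \<subseteq> Field R" using assms(3) by blast
  ultimately have "\<exists>b\<in>Field R. \<forall>x\<in>f ` I. (x, b) \<in> R"
    using assms(1) unfolding directed_def by (elim conjE allE[of _ "f ` I"]) (drule (1) mp)+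
  then show ?thesis using that by blast
qed

lemma directed_bound2:
  assumes "directed \<kappa> R" "regular_cardinal \<kappa>" "i \<in> Field R" "j \<in> Field R"
  obtains k where "k \<in> Field R" "(i, k) \<in> R" "(j, k) \<in> R"
proof -
  have "|{i, j}| <o \<kappa>" by (rule finite_ordLess_regular[OF assms(2)]) simp
  then obtain k where "k \<in> Field R" "\<And>x. x \<in> {i, j} \<Longrightarrow> (x, k) \<in> R"
    using directed_bound[OF assms(1), of "{i, j}" "\<lambda>x. x" thesis] assms(3,4) by force
  then show ?thesis using that by simp
qed

lemma directed_mono:
  assumes "directed \<kappa>' R" "\<kappa> \<le>o \<kappa>'"
  shows "directed \<kappa> R"
  using assms(1) ordLess_ordLeq_trans[OF _ assms(2)] unfolding directed_def by blast

lemma HomD: "f \<in> Hom C A B \<Longrightarrow> f \<in> Arr C \<and> Dom C f = A \<and> Cod C f = B"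
  by (simp add: Hom_def)

text \<open>Directedness is left out, so that the locale also covers restrictions to arbitrary
  subsets of the index poset and the indexing diagram of \<open>presentable_colimit\<close>.\<close>

locale poset_system = category K
  for K :: "('o, 'a) category" +
  fixes R :: "'u rel" and D :: "('u, 'u \<times> 'u, 'o, 'a) functor_data"
  assumes po: "Partial_order R"
    and diagram: "is_functor (poset_cat R) K D"
begin

lemma
  shows omap_in: "i \<in> Field R \<Longrightarrow> omap D i \<in> Obj K"
    and amap_in: "(i, j) \<in> R \<Longrightarrow> amap D (i, j) \<in> Hom K (omap D i) (omap D j)"
    and amap_refl: "i \<in> Field R \<Longrightarrow> amap D (i, i) = Ident K (omap D i)"
    and amap_trans: "(i, j) \<in> R \<Longrightarrow> (j, k) \<in> R \<Longrightarrow>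
        amap D (i, k) = Compose K (amap D (j, k)) (amap D (i, j))"
  using diagram unfolding is_functor_poset_cat_iff[OF po] by blast+

lemma
  assumes "is_cocone (poset_cat R) K D L \<iota>"
  shows cocone_obj: "L \<in> Obj K"
    and cocone_in: "j \<in> Field R \<Longrightarrow> \<iota> j \<in> Hom K (omap D j) L"
    and cocone_comp: "(i, j) \<in> R \<Longrightarrow> Compose K (\<iota> j) (amap D (i, j)) = \<iota> i"
  using assms unfolding is_cocone_poset_cat_iff by blast+

lemma cocone_push:
  assumes c: "is_cocone (poset_cat R) K D L \<iota>" and h: "h \<in> Hom K L N"
  shows "is_cocone (poset_cat R) K D N (\<lambda>j. Compose K h (\<iota> j))"
  unfolding is_cocone_poset_cat_iff
proof (intro conjI ballI allI impI)
  show "N \<in> Obj K" using h Cod_in_Obj by (auto simp: Hom_def)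
next
  fix j assume "j \<in> Field R"
  then show "Compose K h (\<iota> j) \<in> Hom K (omap D j) N"
    using Compose_in_Hom[OF cocone_in[OF c] h] by blast
next
  fix i j assume ij: "(i, j) \<in> R"
  then have "j \<in> Field R" by (simp add: FieldI2)
  then show "Compose K (Compose K h (\<iota> j)) (amap D (i, j)) = Compose K h (\<iota> i)"
    using Compose_assoc[OF amap_in[OF ij] cocone_in[OF c] h] cocone_comp[OF c ij] by simp
qed

lemma colimit_factor:
  assumes "is_colimit (poset_cat R) K D L \<iota>" "is_cocone (poset_cat R) K D N \<nu>"
  obtains h where "h \<in> Hom K L N" "\<And>j. j \<in> Field R \<Longrightarrow> Compose K h (\<iota> j) = \<nu> j"
  using assms unfolding is_colimit_def Obj_poset_cat by metis

text \<open>Both arrows mediate the cocone obtained by composing \<open>h\<close> with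
  \<open>\<iota>\<close>. Equations between arrows out of a colimit are checked this way
  below.\<close>

lemma colimit_joint_epi:
  assumes L: "is_colimit (poset_cat R) K D L \<iota>" and h: "h \<in> Hom K L N" "h' \<in> Hom K L N"
    and eq: "\<And>j. j \<in> Field R \<Longrightarrow> Compose K h (\<iota> j) = Compose K h' (\<iota> j)"
  shows "h = h'"
proof -
  have "\<exists>!g. g \<in> Hom K L N \<and> (\<forall>j\<in>Field R. Compose K g (\<iota> j) = Compose K h (\<iota> j))"
    using L cocone_push[OF is_colimitD_cocone[OF L] h(1)]
    unfolding is_colimit_def Obj_poset_cat by blast
  then show ?thesis using h eq by metis
qed

lemma restrict_system:
  assumes "A \<subseteq> Field R"
  shows "poset_system K (Restr R A) D"
proof
  show po': "Partial_order (Restr R A)" using Partial_order_Restr[OF po] .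
  show "is_functor (poset_cat (Restr R A)) K D"
    unfolding is_functor_poset_cat_iff[OF po'] Field_Restr_subset[OF po assms]
    using omap_in amap_in amap_refl amap_trans assms by blast
qed

end

lemma directed_system_poset_system:
  assumes "category K" "directed_system \<kappa> K R D"
  shows "poset_system K R D"
  using assms
  by (simp add: poset_system_def poset_system_axioms_def directed_system_def directed_def)

section \<open>Presentable objects\<close>

text \<open>For directed systems this says that \<open>Hom(M, -)\<close> carries the cocone to a colimit.\<close>

definition hom_commutes ::
  "('o, 'a) category \<Rightarrow> 'o \<Rightarrow> 'u rel \<Rightarrow> ('u, 'u \<times> 'u, 'o, 'a) functor_data \<Rightarrow> 'o \<Rightarrow>
    ('u \<Rightarrow> 'a) \<Rightarrow> bool" where
  "hom_commutes K M R D L \<iota> \<longleftrightarrow>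
     (\<forall>f\<in>Hom K M L. \<exists>j\<in>Field R. \<exists>g\<in>Hom K M (omap D j). Compose K (\<iota> j) g = f) \<and>
     (\<forall>j\<in>Field R. \<forall>g\<in>Hom K M (omap D j). \<forall>g'\<in>Hom K M (omap D j).
        Compose K (\<iota> j) g = Compose K (\<iota> j) g' \<longrightarrow>
        (\<exists>k. (j, k) \<in> R \<and> Compose K (amap D (j, k)) g = Compose K (amap D (j, k)) g'))"

text \<open>A cocone in Set on the hom-sets, freed from the triples and the extensionality of
  \<open>set_cat\<close>. Values of \<open>n j\<close> off the hom-set are arbitrary, so cocones can
  be given by plain formulas.\<close>

definition hom_cocone ::
  "('o, 'u) category \<Rightarrow> 'o \<Rightarrow> 'u rel \<Rightarrow> ('o, 'u) system \<Rightarrow> 'u set \<Rightarrow> ('u \<Rightarrow> 'u \<Rightarrow> 'u) \<Rightarrow> bool" where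
  "hom_cocone K M R D N n \<longleftrightarrow>
     (\<forall>j\<in>Field R. n j \<in> Hom K M (omap D j) \<rightarrow> N) \<and>
     (\<forall>i j. (i, j) \<in> R \<longrightarrow>
        (\<forall>x\<in>Hom K M (omap D i). n j (Compose K (amap D (i, j)) x) = n i x))"

text \<open>Typing in \<open>set_cat\<close> forces the outer components of each triple, so a cocone
  is carried by the middle ones, and commutation can be evaluated at elements.\<close>

lemma hom_cocone_of_set_cocone:
  assumes K: "category K" and sys: "poset_system K R D"
    and \<nu>: "is_cocone (poset_cat R) set_cat (functor_comp (hom_functor K M) D) N \<nu>"
  shows "\<exists>n. small N \<and> hom_cocone K M R D N n \<and>
    (\<forall>j\<in>Field R. n j \<in> extensional (Hom K M (omap D j)) \<and> \<nu> j = (Hom K M (omap D j), n j, N))"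
proof -
  interpret poset_system K R D by fact
  define n where "n j = fst (snd (\<nu> j))" for j
  have N: "small N" using \<nu> by (simp add: is_cocone_def set_cat_def)
  have n: "\<nu> j = (Hom K M (omap D j), n j, N)" "n j \<in> Hom K M (omap D j) \<rightarrow>\<^sub>E N"
    if "j \<in> Field R" for j
  proof -
    have "\<nu> j \<in> Hom set_cat (Hom K M (omap D j)) N"
      using \<nu> that by (simp add: is_cocone_poset_cat_iff functor_comp_def hom_functor_def)
    then show "\<nu> j = (Hom K M (omap D j), n j, N)" "n j \<in> Hom K M (omap D j) \<rightarrow>\<^sub>E N"
      by (cases "\<nu> j", simp add: Hom_set_cat n_def)+
  qed
  have "n j (Compose K (amap D (i, j)) x) = n i x"
    if ij: "(i, j) \<in> R" and x: "x \<in> Hom K M (omap D i)" for i j x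
  proof -
    have F: "i \<in> Field R" "j \<in> Field R" using ij by (auto simp: Field_def)
    have "Compose set_cat (\<nu> j) (amap (hom_functor K M) (amap D (i, j))) = \<nu> i"
      using \<nu> ij by (auto simp: is_cocone_poset_cat_iff functor_comp_def)
    then have "compose (Hom K M (omap D i)) (n j)
        (\<lambda>x\<in>Hom K M (omap D i). Compose K (amap D (i, j)) x) = n i"
      using n(1)[OF F(1)] n(1)[OF F(2)] HomD[OF amap_in[OF ij]]
      by (simp add: set_cat_def hom_functor_def)
    then show ?thesis using x by (metis compose_eq restrict_apply')
  qed
  then show ?thesis using N n by (intro exI[of _ n]) (auto simp: hom_cocone_def PiE_def)
qed

lemma set_cocone_of_hom_cocone:
  assumes K: "category K" "locally_small K" "M \<in> Obj K" and sys: "poset_system K R D"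
    and N: "small N" and n: "hom_cocone K M R D N n"
  shows "is_cocone (poset_cat R) set_cat (functor_comp (hom_functor K M) D) N
    (\<lambda>j. (Hom K M (omap D j), restrict (n j) (Hom K M (omap D j)), N))"
proof -
  interpret poset_system K R D by fact
  show ?thesis
    unfolding is_cocone_poset_cat_iff
  proof (intro conjI ballI allI impI)
    show "N \<in> Obj set_cat" using N by (simp add: set_cat_def)
  next
    fix j assume j: "j \<in> Field R"
    then have "small (Hom K M (omap D j))" using K omap_in by (simp add: locally_small_def)
    moreover have "n j \<in> Hom K M (omap D j) \<rightarrow> N" using n j by (simp add: hom_cocone_def)
    ultimately show "(Hom K M (omap D j), restrict (n j) (Hom K M (omap D j)), N)
        \<in> Hom set_cat (omap (functor_comp (hom_functor K M) D) j) N"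
      using N by (auto simp: Hom_set_cat functor_comp_def hom_functor_def)
  next
    fix i j assume ij: "(i, j) \<in> R"
    have "n j (Compose K (amap D (i, j)) x) = n i x" "Compose K (amap D (i, j)) x \<in> Hom K M (omap D j)"
      if "x \<in> Hom K M (omap D i)" for x
      using n ij that Compose_in_Hom[OF that amap_in[OF ij]] by (auto simp: hom_cocone_def)
    then show "Compose set_cat (Hom K M (omap D j), restrict (n j) (Hom K M (omap D j)), N)
        (amap (functor_comp (hom_functor K M) D) (i, j)) =
        (Hom K M (omap D i), restrict (n i) (Hom K M (omap D i)), N)"
      using HomD[OF amap_in[OF ij]]
      by (auto simp: set_cat_def functor_comp_def hom_functor_def compose_def restrict_def fun_eq_iff)
  qed
qed

lemma set_factor_iff:
  assumes \<iota>: "\<iota> \<in> Hom K A L"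
  shows "Compose set_cat (Hom K M L, h, N) (amap (hom_functor K M) \<iota>) = (Hom K M A, n, N) \<longleftrightarrow>
    n \<in> extensional (Hom K M A) \<and> (\<forall>x\<in>Hom K M A. h (Compose K \<iota> x) = n x)"
  using HomD[OF \<iota>]
  by (auto simp: set_cat_def hom_functor_def compose_def restrict_def fun_eq_iff extensional_def)

text \<open>The two translations of cocones turn the universal property in \<open>set_cat\<close>
  into one about plain functions.\<close>

lemma hom_colimit_iff:
  assumes K: "category K" "locally_small K" "M \<in> Obj K" and sys: "poset_system K R D"
    and c: "is_cocone (poset_cat R) K D L \<iota>"
  shows "is_colimit (poset_cat R) set_cat (functor_comp (hom_functor K M) D)
      (omap (hom_functor K M) L) (amap (hom_functor K M) \<circ> \<iota>) \<longleftrightarrow>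
    (\<forall>N n. small N \<and> hom_cocone K M R D N n \<longrightarrow>
      (\<exists>!h. h \<in> Hom K M L \<rightarrow>\<^sub>E N \<and>
        (\<forall>j\<in>Field R. \<forall>x\<in>Hom K M (omap D j). h (Compose K (\<iota> j) x) = n j x)))"
    (is "?colim \<longleftrightarrow> ?elem")
proof -
  interpret poset_system K R D by fact
  have sm: "small (Hom K M L)" using K(2,3) cocone_obj[OF c] by (simp add: locally_small_def)
  let ?H = "hom_functor K M"
  have cocone: "is_cocone (poset_cat R) set_cat (functor_comp ?H D) (omap ?H L) (amap ?H \<circ> \<iota>)"
    unfolding is_cocone_poset_cat_iff
  proof (intro conjI ballI allI impI)
    note F = is_functor_hom_functor[OF K, unfolded is_functor_def]
    show "omap ?H L \<in> Obj set_cat" using F cocone_obj[OF c] by blast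
    show "(amap ?H \<circ> \<iota>) j \<in> Hom set_cat (omap (functor_comp ?H D) j) (omap ?H L)"
      if "j \<in> Field R" for j
      using F HomD[OF cocone_in[OF c that]] by (auto simp: functor_comp_def)
    fix i j assume ij: "(i, j) \<in> R"
    then have "j \<in> Field R" by (simp add: FieldI2)
    then have "amap ?H (Compose K (\<iota> j) (amap D (i, j))) =
        Compose set_cat (amap ?H (\<iota> j)) (amap ?H (amap D (i, j)))"
      using F HomD[OF cocone_in[OF c]] HomD[OF amap_in[OF ij]] by metis
    then show "Compose set_cat ((amap ?H \<circ> \<iota>) j) (amap (functor_comp ?H D) (i, j)) =
        (amap ?H \<circ> \<iota>) i"
      using cocone_comp[OF c ij] by (simp add: functor_comp_def)
  qed
  \<comment> \<open>The ends of an arrow \<open>t\<close> are forced, so mediating arrows correspond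
    to mediating functions; \<open>ex1\<close> then transfers unique existence along this
    correspondence.\<close>
  have med: "(t \<in> Hom set_cat (omap ?H L) N \<and>
        (\<forall>j\<in>Field R. Compose set_cat t ((amap ?H \<circ> \<iota>) j) = (Hom K M (omap D j), n j, N))) \<longleftrightarrow>
      (\<exists>h. t = (Hom K M L, h, N) \<and> h \<in> Hom K M L \<rightarrow>\<^sub>E N \<and>
        (\<forall>j\<in>Field R. \<forall>x\<in>Hom K M (omap D j). h (Compose K (\<iota> j) x) = n j x))"
    if N: "small N" and n: "\<forall>j\<in>Field R. n j \<in> extensional (Hom K M (omap D j))" for t N n
  proof -
    have "(t \<in> Hom set_cat (omap ?H L) N) \<longleftrightarrow>
        (\<exists>h. t = (Hom K M L, h, N) \<and> h \<in> Hom K M L \<rightarrow>\<^sub>E N)"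
      using N sm by (auto simp: Hom_set_cat hom_functor_def)
    moreover have "Compose set_cat (Hom K M L, h, N) ((amap ?H \<circ> \<iota>) j) =
        (Hom K M (omap D j), n j, N) \<longleftrightarrow>
        (\<forall>x\<in>Hom K M (omap D j). h (Compose K (\<iota> j) x) = n j x)" if "j \<in> Field R" for h j
      using set_factor_iff[OF cocone_in[OF c that]] n that by simp
    ultimately show ?thesis by blast
  qed
  have ex1: "(\<exists>!t. \<exists>h. t = (A, h, N) \<and> P h) \<longleftrightarrow> (\<exists>!h. P h)"
    for A :: "'u set" and N :: "'u set" and P :: "('u \<Rightarrow> 'u) \<Rightarrow> bool"
    by (auto simp: Ex1_def)
  show ?thesis
  proof
    assume colim: ?colim
    show ?elem
    proof (intro allI impI, elim conjE)
      fix N n assume N: "small N" and n: "hom_cocone K M R D N n"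
      let ?n = "\<lambda>j. restrict (n j) (Hom K M (omap D j))"
      have "\<exists>!t. t \<in> Hom set_cat (omap ?H L) N \<and>
          (\<forall>j\<in>Field R. Compose set_cat t ((amap ?H \<circ> \<iota>) j) = (Hom K M (omap D j), ?n j, N))"
        using colim set_cocone_of_hom_cocone[OF K sys N n]
        unfolding is_colimit_def Obj_poset_cat by (elim conjE allE) (erule mp)
      then show "\<exists>!h. h \<in> Hom K M L \<rightarrow>\<^sub>E N \<and>
          (\<forall>j\<in>Field R. \<forall>x\<in>Hom K M (omap D j). h (Compose K (\<iota> j) x) = n j x)"
        using med[OF N, of ?n] ex1[of "Hom K M L" N] by simp
    qed
  next
    assume elem: ?elem
    show ?colim
      unfolding is_colimit_def Obj_poset_cat
    proof (intro conjI allI impI cocone)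
      fix N \<nu> assume \<nu>: "is_cocone (poset_cat R) set_cat (functor_comp ?H D) N \<nu>"
      obtain n where N: "small N" and n: "hom_cocone K M R D N n"
        and ext: "\<forall>j\<in>Field R. n j \<in> extensional (Hom K M (omap D j))"
        and \<nu>_eq: "\<And>j. j \<in> Field R \<Longrightarrow> \<nu> j = (Hom K M (omap D j), n j, N)"
        using hom_cocone_of_set_cocone[OF K(1) sys \<nu>] by blast
      have "\<exists>!t. t \<in> Hom set_cat (omap ?H L) N \<and>
          (\<forall>j\<in>Field R. Compose set_cat t ((amap ?H \<circ> \<iota>) j) = (Hom K M (omap D j), n j, N))"
        unfolding med[OF N, of n, OF ext] ex1 by (rule elem[rule_format, OF conjI[OF N n]])
      then show "\<exists>!t. t \<in> Hom set_cat (omap ?H L) N \<and>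
          (\<forall>j\<in>Field R. Compose set_cat t ((amap ?H \<circ> \<iota>) j) = \<nu> j)"
        using \<nu>_eq by simp
    qed
  qed
qed

section \<open>Presentability as factorization through the stages of a directed system\<close>

context poset_system
begin

lemma amap_comp:
  assumes "(i, j) \<in> R" "(j, k) \<in> R" "x \<in> Hom K X (omap D i)"
  shows "Compose K (amap D (j, k)) (Compose K (amap D (i, j)) x) = Compose K (amap D (i, k)) x"
  using Compose_assoc[OF assms(3) amap_in[OF assms(1)] amap_in[OF assms(2)]]
    amap_trans[OF assms(1,2)] by simp

lemma cocone_amap:
  assumes "is_cocone (poset_cat R) K D L \<iota>" "(i, j) \<in> R" "x \<in> Hom K X (omap D i)"
  shows "Compose K (\<iota> j) (Compose K (amap D (i, j)) x) = Compose K (\<iota> i) x"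
  using Compose_assoc[OF assms(3) amap_in[OF assms(2)] cocone_in[OF assms(1) FieldI2[OF assms(2)]]]
    cocone_comp[OF assms(1,2)] by simp

lemma amap_hom:
  "(i, j) \<in> R \<Longrightarrow> x \<in> Hom K X (omap D i) \<Longrightarrow>
    Compose K (amap D (i, j)) x \<in> Hom K X (omap D j)"
  using Compose_in_Hom amap_in by blast

lemma order_trans: "(i, j) \<in> R \<Longrightarrow> (j, k) \<in> R \<Longrightarrow> (i, k) \<in> R"
  using po by (auto simp: partial_order_on_def preorder_on_def dest: transD)

lemma order_refl: "i \<in> Field R \<Longrightarrow> (i, i) \<in> R"
  using Partial_order_refl[OF po] .

end

lemma hom_commutesD:
  assumes "hom_commutes K M R D L \<iota>"
  shows hom_commutes_factor: "f \<in> Hom K M L \<Longrightarrow>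
      \<exists>j\<in>Field R. \<exists>g\<in>Hom K M (omap D j). Compose K (\<iota> j) g = f"
    and hom_commutes_unique: "j \<in> Field R \<Longrightarrow> g \<in> Hom K M (omap D j) \<Longrightarrow>
      g' \<in> Hom K M (omap D j) \<Longrightarrow> Compose K (\<iota> j) g = Compose K (\<iota> j) g' \<Longrightarrow>
      \<exists>k. (j, k) \<in> R \<and> Compose K (amap D (j, k)) g = Compose K (amap D (j, k)) g'"
  using assms by (simp_all add: hom_commutes_def)

text \<open>Cocones into a two-element set suffice to detect both halves of \<open>hom_commutes\<close>.\<close>

lemma hom_commutes_of_colimit:
  fixes K :: "('o, 'u) category"
  assumes sys: "poset_system K R D"
    and \<kappa>: "regular_cardinal \<kappa>" and R: "directed \<kappa> R"
    and c: "is_cocone (poset_cat R) K D L \<iota>"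
    and small2: "\<And>p q :: 'u. small {p, q}" and pq: "(p :: 'u) \<noteq> q"
    and colim: "\<And>N n. small N \<Longrightarrow> hom_cocone K M R D N n \<Longrightarrow>
      (\<exists>!h. h \<in> Hom K M L \<rightarrow>\<^sub>E N \<and>
        (\<forall>j\<in>Field R. \<forall>x\<in>Hom K M (omap D j). h (Compose K (\<iota> j) x) = n j x))"
  shows "hom_commutes K M R D L \<iota>"
  unfolding hom_commutes_def
proof (intro conjI ballI impI)
  interpret poset_system K R D by fact
  fix f assume f: "f \<in> Hom K M L"
  show "\<exists>j\<in>Field R. \<exists>g\<in>Hom K M (omap D j). Compose K (\<iota> j) g = f"
  proof (rule ccontr)
    assume no: "\<not> ?thesis"
    have "hom_cocone K M R D {p, q} (\<lambda>j x. p)" by (simp add: hom_cocone_def)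
    note u = colim[OF small2 this]
    \<comment> \<open>If \<open>f\<close> factors through no stage, the constant map and the map
      altered at \<open>f\<close> alone mediate the same constant cocone, against
      uniqueness.\<close>
    let ?h1 = "\<lambda>x\<in>Hom K M L. p" and ?h2 = "\<lambda>x\<in>Hom K M L. if x = f then q else p"
    have "Compose K (\<iota> j) x \<in> Hom K M L" if "j \<in> Field R" "x \<in> Hom K M (omap D j)" for j x
      using Compose_in_Hom[OF that(2) cocone_in[OF c that(1)]] .
    then have "?h1 = ?h2" using no
      by (intro trans[OF the1_equality[OF u, symmetric] the1_equality[OF u]]) auto
    then have "?h1 f = ?h2 f" by metis
    then show False using f pq by simp
  qed
next
  interpret poset_system K R D by fact
  fix j g g' assume j: "j \<in> Field R" and g: "g \<in> Hom K M (omap D j)" "g' \<in> Hom K M (omap D j)"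
    and eq: "Compose K (\<iota> j) g = Compose K (\<iota> j) g'"
  \<comment> \<open>\<open>?P k z l\<close> says that \<open>g\<close> and \<open>z\<close> become
    equal at stage \<open>l\<close>. So \<open>?n\<close> is the characteristic function of the
    class of \<open>g\<close> in the directed colimit of the hom-sets.\<close>
  let ?P = "\<lambda>k z l. (j, l) \<in> R \<and> (k, l) \<in> R \<and>
    Compose K (amap D (j, l)) g = Compose K (amap D (k, l)) z"
  let ?n = "\<lambda>k z. if \<exists>l. ?P k z l then p else q"
  have "(\<exists>l. ?P k (Compose K (amap D (i, k)) x) l) = (\<exists>l. ?P i x l)"
    if ik: "(i, k) \<in> R" and x: "x \<in> Hom K M (omap D i)" for i k x
  proof
    assume "\<exists>l. ?P k (Compose K (amap D (i, k)) x) l"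
    then obtain l where "?P k (Compose K (amap D (i, k)) x) l" by blast
    then have "?P i x l" using ik amap_comp[OF ik _ x] order_trans by metis
    then show "\<exists>l. ?P i x l" by blast
  next
    assume "\<exists>l. ?P i x l"
    then obtain l where l: "?P i x l" by blast
    then have "l \<in> Field R" "k \<in> Field R" using ik by (auto simp: Field_def)
    \<comment> \<open>The equality reached at \<open>l\<close> persists at \<open>m\<close>, a stage
      that also lies above \<open>k\<close>.\<close>
    then obtain m where m: "(l, m) \<in> R" "(k, m) \<in> R" using directed_bound2[OF R \<kappa>] by metis
    have "Compose K (amap D (j, m)) g = Compose K (amap D (l, m)) (Compose K (amap D (j, l)) g)"
      using amap_comp[OF _ m(1) g(1)] l by simp
    also have "\<dots> = Compose K (amap D (i, m)) x" using l amap_comp[OF _ m(1) x] by simp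
    also have "\<dots> = Compose K (amap D (k, m)) (Compose K (amap D (i, k)) x)"
      using amap_comp[OF ik m(2) x] by simp
    finally show "\<exists>l. ?P k (Compose K (amap D (i, k)) x) l" using m l order_trans by blast
  qed
  then have "hom_cocone K M R D {p, q} ?n" by (auto simp: hom_cocone_def)
  then obtain h where h: "\<And>k x. k \<in> Field R \<Longrightarrow> x \<in> Hom K M (omap D k) \<Longrightarrow>
      h (Compose K (\<iota> k) x) = ?n k x"
    using ex1_implies_ex[OF colim[OF small2]] by blast
  \<comment> \<open>\<open>h\<close> sees only the common composite with \<open>\<iota> j\<close>;
    as \<open>g\<close> is in its own class, so is \<open>g'\<close>.\<close>
  have "?n j g = ?n j g'" using h[OF j g(1)] h[OF j g(2)] eq by simp
  moreover have "?P j g j" using order_refl[OF j] by simp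
  ultimately have "\<exists>l. ?P j g' l" using pq by metis
  then show "\<exists>k. (j, k) \<in> R \<and> Compose K (amap D (j, k)) g = Compose K (amap D (j, k)) g'" by blast
qed

text \<open>The mediating function sends \<open>f\<close> to the value of \<open>n\<close> on any
  factorization of \<open>f\<close> through a stage. Two factorizations are moved to a common upper
  bound, where the uniqueness half of \<open>hom_commutes\<close> makes them equal at a later
  stage.\<close>

lemma colimit_of_hom_commutes:
  fixes K :: "('o, 'u) category"
  assumes sys: "poset_system K R D"
    and \<kappa>: "regular_cardinal \<kappa>" and R: "directed \<kappa> R"
    and c: "is_cocone (poset_cat R) K D L \<iota>"
    and hc: "hom_commutes K M R D L \<iota>" and n: "hom_cocone K M R D N n"
  shows "\<exists>!h. h \<in> Hom K M L \<rightarrow>\<^sub>E N \<and>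
        (\<forall>j\<in>Field R. \<forall>x\<in>Hom K M (omap D j). h (Compose K (\<iota> j) x) = n j x)"
proof -
  interpret poset_system K R D by fact
  have n_in: "n j x \<in> N" if "j \<in> Field R" "x \<in> Hom K M (omap D j)" for j x
    using n that by (auto simp: hom_cocone_def)
  have n_eq: "n j (Compose K (amap D (i, j)) x) = n i x"
    if "(i, j) \<in> R" "x \<in> Hom K M (omap D i)" for i j x
    using n that by (auto simp: hom_cocone_def)
  have ex: "\<exists>j g. j \<in> Field R \<and> g \<in> Hom K M (omap D j) \<and> Compose K (\<iota> j) g = f"
    if "f \<in> Hom K M L" for f
    using hom_commutes_factor[OF hc that] by blast
  have wd: "n j g = n j' g'"
    if j: "j \<in> Field R" "j' \<in> Field R" and g: "g \<in> Hom K M (omap D j)" "g' \<in> Hom K M (omap D j')"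
      and eq: "Compose K (\<iota> j) g = Compose K (\<iota> j') g'" for j j' g g'
  proof -
    obtain k where k: "k \<in> Field R" "(j, k) \<in> R" "(j', k) \<in> R"
      using directed_bound2[OF R \<kappa> j] .
    have "Compose K (\<iota> k) (Compose K (amap D (j, k)) g) = Compose K (\<iota> k) (Compose K (amap D (j', k)) g')"
      using cocone_amap[OF c k(2) g(1)] cocone_amap[OF c k(3) g(2)] eq by simp
    then obtain l where l: "(k, l) \<in> R" "Compose K (amap D (k, l)) (Compose K (amap D (j, k)) g) =
        Compose K (amap D (k, l)) (Compose K (amap D (j', k)) g')"
      using hom_commutes_unique[OF hc k(1) amap_hom[OF k(2) g(1)] amap_hom[OF k(3) g(2)]] by blast
    have "Compose K (amap D (j, l)) g = Compose K (amap D (j', l)) g'"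
      using l(2) amap_comp[OF k(2) l(1) g(1)] amap_comp[OF k(3) l(1) g(2)] by simp
    then show ?thesis
      using n_eq[OF order_trans[OF k(2) l(1)] g(1)] n_eq[OF order_trans[OF k(3) l(1)] g(2)] by simp
  qed
  obtain J G where JG: "\<And>f. f \<in> Hom K M L \<Longrightarrow>
      J f \<in> Field R \<and> G f \<in> Hom K M (omap D (J f)) \<and> Compose K (\<iota> (J f)) (G f) = f"
    using ex by metis
  let ?h = "\<lambda>f\<in>Hom K M L. n (J f) (G f)"
  show ?thesis
  proof (rule ex1I[of _ ?h], intro conjI ballI)
    show "?h \<in> Hom K M L \<rightarrow>\<^sub>E N" using n_in JG by auto
    show "?h (Compose K (\<iota> j) x) = n j x" if j: "j \<in> Field R" and x: "x \<in> Hom K M (omap D j)" for j x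
    proof -
      have f: "Compose K (\<iota> j) x \<in> Hom K M L" using Compose_in_Hom[OF x cocone_in[OF c j]] .
      then show ?thesis using wd[OF _ j _ x] JG[OF f] by simp
    qed
    fix h assume h: "h \<in> Hom K M L \<rightarrow>\<^sub>E N \<and>
        (\<forall>j\<in>Field R. \<forall>x\<in>Hom K M (omap D j). h (Compose K (\<iota> j) x) = n j x)"
    show "h = ?h"
    proof
      fix f
      show "h f = ?h f"
      proof (cases "f \<in> Hom K M L")
        case True
        then have "h (Compose K (\<iota> (J f)) (G f)) = n (J f) (G f)" using h JG by blast
        then show ?thesis using JG[OF True] True by simp
      next
        case False
        then show ?thesis using h by (auto simp: PiE_def extensional_def)
      qed
    qed
  qed
qed

lemma presentable_iff:
  fixes K :: "('o, 'u) category"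
  assumes univ: "universe TYPE('u)" and K: "category K" "locally_small K" and \<kappa>: "regular_cardinal \<kappa>"
  shows "presentable K \<kappa> M \<longleftrightarrow> M \<in> Obj K \<and>
    (\<forall>R D L \<iota>. directed_system \<kappa> K R D \<and> is_colimit (poset_cat R) K D L \<iota> \<longrightarrow>
      hom_commutes K M R D L \<iota>)"
proof -
  \<comment> \<open>The test cocones take values in a doubleton. An infinite universe provides two
    distinct elements and makes doubletons small.\<close>
  have inf: "infinite (UNIV :: 'u set)"
    using univ natLeq_ordLeq_cinfinite
    unfolding universe_def strongly_inaccessible_def
    by (metis card_of_Card_order card_of_ordLeq_finite card_of_nat infinite_UNIV_nat
        ordIso_ordLeq_trans ordLess_imp_ordLeq)
  then obtain p q :: 'u where pq: "p \<noteq> q" by (metis ex_new_if_finite finite.emptyI finite.insertI insertCI)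
  have small2: "small {p, q}" for p q :: 'u
    unfolding small_def
    by (rule finite_ordLess_infinite[OF card_of_Well_order card_of_Well_order])
      (use inf in \<open>simp_all add: Field_card_of\<close>)
  have "is_colimit (poset_cat R) set_cat (functor_comp (hom_functor K M) D)
      (omap (hom_functor K M) L) (amap (hom_functor K M) \<circ> \<iota>) \<longleftrightarrow> hom_commutes K M R D L \<iota>"
    if M: "M \<in> Obj K" and D: "directed_system \<kappa> K R D" and L: "is_colimit (poset_cat R) K D L \<iota>"
    for R D L \<iota>
  proof -
    have sys: "poset_system K R D" using directed_system_poset_system[OF K(1) D] .
    have R: "directed \<kappa> R" using D by (simp add: directed_system_def)
    note c = is_colimitD_cocone[OF L]
    show ?thesis
      unfolding hom_colimit_iff[OF K M sys c]
    proof
      assume "\<forall>N n. small N \<and> hom_cocone K M R D N n \<longrightarrow>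
        (\<exists>!h. h \<in> Hom K M L \<rightarrow>\<^sub>E N \<and>
          (\<forall>j\<in>Field R. \<forall>x\<in>Hom K M (omap D j). h (Compose K (\<iota> j) x) = n j x))"
      then show "hom_commutes K M R D L \<iota>"
        using hom_commutes_of_colimit[OF sys \<kappa> R c small2 pq, of M] by blast
    next
      assume hc: "hom_commutes K M R D L \<iota>"
      show "\<forall>N n. small N \<and> hom_cocone K M R D N n \<longrightarrow>
        (\<exists>!h. h \<in> Hom K M L \<rightarrow>\<^sub>E N \<and>
          (\<forall>j\<in>Field R. \<forall>x\<in>Hom K M (omap D j). h (Compose K (\<iota> j) x) = n j x))"
        using colimit_of_hom_commutes[OF sys \<kappa> R c hc] by simp
    qed
  qed
  then show ?thesis unfolding presentable_def preserves_directed_colimits_def by metis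
qed

section \<open>Presentability under larger cardinals, retracts and small colimits\<close>

lemma presentable_mono:
  assumes "presentable K \<kappa> M" "\<kappa> \<le>o \<kappa>'"
  shows "presentable K \<kappa>' M"
  using assms(1) directed_mono[OF _ assms(2)]
  unfolding presentable_def preserves_directed_colimits_def directed_system_def by metis

text \<open>Precomposing with \<open>r\<close> moves arrows out of \<open>M\<close> to arrows out of
  \<open>N\<close>, where \<open>hom_commutes\<close> is known; precomposing with \<open>s\<close>
  brings the results back, since \<open>r\<close> after \<open>s\<close> is the identity.\<close>

lemma presentable_retract:
  fixes K :: "('o, 'u) category"
  assumes univ: "universe TYPE('u)" and K: "category K" "locally_small K" and \<kappa>: "regular_cardinal \<kappa>"
    and N: "presentable K \<kappa> N"
    and s: "s \<in> Hom K M N" and r: "r \<in> Hom K N M" and rs: "Compose K r s = Ident K M"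
  shows "presentable K \<kappa> M"
  unfolding presentable_iff[OF univ K \<kappa>]
proof (intro conjI allI impI; (elim conjE)?)
  interpret category K by fact
  show "M \<in> Obj K" using s Dom_in_Obj by (auto simp: Hom_def)
  fix R D L \<iota> assume D: "directed_system \<kappa> K R D" and L: "is_colimit (poset_cat R) K D L \<iota>"
  interpret poset_system K R D using directed_system_poset_system[OF K(1) D] .
  note c = is_colimitD_cocone[OF L]
  have N: "hom_commutes K N R D L \<iota>" using N D L unfolding presentable_iff[OF univ K \<kappa>] by blast
  have retr: "Compose K (Compose K f r) s = f" if "f \<in> Hom K M X" for f X
    using Compose_assoc[OF s r that] rs Compose_Ident_right[OF that] by simp
  show "hom_commutes K M R D L \<iota>"
    unfolding hom_commutes_def
  proof (intro conjI ballI impI)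
    fix f assume f: "f \<in> Hom K M L"
    obtain j g where j: "j \<in> Field R" and g: "g \<in> Hom K N (omap D j)" "Compose K (\<iota> j) g = Compose K f r"
      using hom_commutes_factor[OF N Compose_in_Hom[OF r f]] by blast
    have "Compose K (\<iota> j) (Compose K g s) = f"
      using Compose_assoc[OF s g(1) cocone_in[OF c j]] g(2) retr[OF f] by simp
    then show "\<exists>j\<in>Field R. \<exists>g\<in>Hom K M (omap D j). Compose K (\<iota> j) g = f"
      using j Compose_in_Hom[OF s g(1)] by blast
  next
    fix j g g' assume j: "j \<in> Field R" and g: "g \<in> Hom K M (omap D j)" "g' \<in> Hom K M (omap D j)"
      and eq: "Compose K (\<iota> j) g = Compose K (\<iota> j) g'"
    have "Compose K (\<iota> j) (Compose K g r) = Compose K (\<iota> j) (Compose K g' r)"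
      using Compose_assoc[OF r g(1) cocone_in[OF c j]] Compose_assoc[OF r g(2) cocone_in[OF c j]] eq
      by simp
    then obtain k where k: "(j, k) \<in> R"
      "Compose K (amap D (j, k)) (Compose K g r) = Compose K (amap D (j, k)) (Compose K g' r)"
      using hom_commutes_unique[OF N j Compose_in_Hom[OF r g(1)] Compose_in_Hom[OF r g(2)]] by blast
    have "Compose K (Compose K (amap D (j, k)) g) r = Compose K (Compose K (amap D (j, k)) g') r"
      using k(2) Compose_assoc[OF r g(1) amap_in[OF k(1)]] Compose_assoc[OF r g(2) amap_in[OF k(1)]]
      by simp
    then have "Compose K (amap D (j, k)) g = Compose K (amap D (j, k)) g'"
      by (rule trans[OF retr[OF amap_hom[OF k(1) g(1)], symmetric]
            trans[OF arg_cong[of _ _ "\<lambda>f. Compose K f s"] retr[OF amap_hom[OF k(1) g(2)]]]])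
    then show "\<exists>k. (j, k) \<in> R \<and> Compose K (amap D (j, k)) g = Compose K (amap D (j, k)) g'"
      by (intro exI[of _ k] conjI k(1))
  qed
qed

text \<open>\<open>S\<close> is covered by fewer than \<open>\<kappa>\<close> slices of size below
  \<open>\<kappa>\<close>. This bounds the number of commutation conditions in
  \<open>presentable_colimit\<close>, one for each arrow of the index poset.\<close>

lemma regular_relation:
  assumes "regular_cardinal \<kappa>" "|Field S| <o \<kappa>"
  shows "|S| <o \<kappa>"
proof -
  have "|\<Union>i\<in>Field S. Pair i ` Field S| <o \<kappa>"
    by (intro regular_UN[OF assms] ordLeq_ordLess_trans[OF card_of_image assms(2)])
  moreover have "S \<subseteq> (\<Union>i\<in>Field S. Pair i ` Field S)" by (auto simp: Field_def)
  ultimately show ?thesis using ordLeq_ordLess_trans[OF card_of_mono1] by blast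
qed

text \<open>In \<open>Set\<close>, \<open>\<kappa>\<close>-directed colimits commute with limits of size \<open><\<kappa>\<close>; here the limit is
  \<open>Hom(N, -) = lim Hom(E i, -)\<close>.\<close>

lemma presentable_colimit:
  fixes K :: "('o, 'u) category" and S :: "'u rel"
  assumes univ: "universe TYPE('u)" and K: "category K" "locally_small K" and \<kappa>: "regular_cardinal \<kappa>"
    and S: "poset_system K S E" "|Field S| <o \<kappa>"
    and E: "\<And>i. i \<in> Field S \<Longrightarrow> presentable K \<kappa> (omap E i)"
    and N: "is_colimit (poset_cat S) K E N \<epsilon>"
  shows "presentable K \<kappa> N"
  unfolding presentable_iff[OF univ K \<kappa>]
proof (intro conjI allI impI; (elim conjE)?)
  interpret S: poset_system K S E by fact
  note cN = is_colimitD_cocone[OF N]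
  show NO: "N \<in> Obj K" using S.cocone_obj[OF cN] .
  fix R D L \<iota> assume D: "directed_system \<kappa> K R D" and L: "is_colimit (poset_cat R) K D L \<iota>"
  interpret R: poset_system K R D using directed_system_poset_system[OF K(1) D] .
  note cL = is_colimitD_cocone[OF L]
  have R: "directed \<kappa> R" using D by (simp add: directed_system_def)
  have hc: "hom_commutes K (omap E i) R D L \<iota>" if "i \<in> Field S" for i
    using E[OF that] D L unfolding presentable_iff[OF univ K \<kappa>] by simp
  note assoc = S.Compose_assoc and comp_in = S.Compose_in_Hom
  note \<epsilon> = S.cocone_in[OF cN] and \<iota> = R.cocone_in[OF cL]
  have bound: "\<exists>t. (s, t) \<in> R \<and> (\<forall>i\<in>I. (T i, t) \<in> R)"
    if s: "s \<in> Field R" and T: "|I| <o \<kappa>" "\<And>i. i \<in> I \<Longrightarrow> T i \<in> Field R" for s T and I :: "'b set"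
  proof -
    obtain b where b: "b \<in> Field R" "\<And>i. i \<in> I \<Longrightarrow> (T i, b) \<in> R"
      using directed_bound[OF R T(1), of T] T(2) by metis
    obtain t where "t \<in> Field R" "(s, t) \<in> R" "(b, t) \<in> R"
      using directed_bound2[OF R \<kappa> s b(1)] .
    then show ?thesis using b(2) R.order_trans by (intro exI[of _ t]) blast
  qed
  show "hom_commutes K N R D L \<iota>"
    unfolding hom_commutes_def
  proof (intro conjI ballI impI)
    fix f assume f: "f \<in> Hom K N L"
    have "\<exists>j g. j \<in> Field R \<and> g \<in> Hom K (omap E i) (omap D j) \<and>
        Compose K (\<iota> j) g = Compose K f (\<epsilon> i)" if i: "i \<in> Field S" for i
      using hom_commutes_factor[OF hc[OF i] comp_in[OF \<epsilon>[OF i] f]] by blast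
    then obtain J G where JG: "\<And>i. i \<in> Field S \<Longrightarrow> J i \<in> Field R"
      "\<And>i. i \<in> Field S \<Longrightarrow> G i \<in> Hom K (omap E i) (omap D (J i))"
      "\<And>i. i \<in> Field S \<Longrightarrow> Compose K (\<iota> (J i)) (G i) = Compose K f (\<epsilon> i)"
      by metis
    \<comment> \<open>With fewer than \<open>\<kappa>\<close> indices, one stage \<open>s\<close>
      carries factorizations \<open>H i\<close> of all the arrows \<open>f\<close> after
      \<open>\<epsilon> i\<close>.\<close>
    obtain s where s: "s \<in> Field R" "\<And>i. i \<in> Field S \<Longrightarrow> (J i, s) \<in> R"
      using directed_bound[OF R S(2), of J] JG(1) by blast
    define H where "H i = Compose K (amap D (J i, s)) (G i)" for i
    have H: "H i \<in> Hom K (omap E i) (omap D s)" "Compose K (\<iota> s) (H i) = Compose K f (\<epsilon> i)"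
      if i: "i \<in> Field S" for i
      unfolding H_def
      using R.amap_hom[OF s(2)[OF i] JG(2)[OF i]] R.cocone_amap[OF cL s(2)[OF i] JG(2)[OF i]] JG(3)[OF i]
      by simp_all
    \<comment> \<open>The \<open>H i\<close> are known to be compatible only after composing with
      \<open>\<iota> s\<close>. For each arrow \<open>p\<close> of \<open>S\<close>, presentability
      of its source gives a stage at which its condition holds.\<close>
    have "\<exists>t. (s, t) \<in> R \<and> Compose K (amap D (s, t)) (Compose K (H (snd p)) (amap E p)) =
        Compose K (amap D (s, t)) (H (fst p))" if p: "p \<in> S" for p
    proof -
      obtain i j where ij: "p = (i, j)" "(i, j) \<in> S" using p by (cases p) auto
      then have F: "i \<in> Field S" "j \<in> Field S" by (auto simp: Field_def)
      have "Compose K (\<iota> s) (Compose K (H j) (amap E (i, j))) = Compose K (\<iota> s) (H i)"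
        using assoc[OF S.amap_in[OF ij(2)] H(1)[OF F(2)] \<iota>[OF s(1)]]
          assoc[OF S.amap_in[OF ij(2)] \<epsilon>[OF F(2)] f] S.cocone_comp[OF cN ij(2)]
          H(2)[OF F(1)] H(2)[OF F(2)] by simp
      then show ?thesis
        using hom_commutes_unique[OF hc[OF F(1)] s(1) comp_in[OF S.amap_in[OF ij(2)] H(1)[OF F(2)]]
            H(1)[OF F(1)]] ij(1) by simp
    qed
    then obtain T where T: "\<And>p. p \<in> S \<Longrightarrow> (s, T p) \<in> R"
      "\<And>p. p \<in> S \<Longrightarrow> Compose K (amap D (s, T p)) (Compose K (H (snd p)) (amap E p)) =
        Compose K (amap D (s, T p)) (H (fst p))"
      by metis
    \<comment> \<open>One stage \<open>t\<close> above all \<open>T p\<close> makes the conditions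
      hold together, so the \<open>?H i\<close> form a cocone and induce the arrow \<open>g\<close>
      out of \<open>N\<close>.\<close>
    obtain t where t: "(s, t) \<in> R" "\<And>p. p \<in> S \<Longrightarrow> (T p, t) \<in> R"
      using bound[OF s(1) regular_relation[OF \<kappa> S(2)], of T] FieldI2[OF T(1)] by blast
    have tF: "t \<in> Field R" using FieldI2[OF t(1)] .
    let ?H = "\<lambda>i. Compose K (amap D (s, t)) (H i)"
    have "is_cocone (poset_cat S) K E (omap D t) ?H"
      unfolding is_cocone_poset_cat_iff
    proof (intro conjI ballI allI impI)
      show "omap D t \<in> Obj K" using R.omap_in[OF tF] .
      show "?H j \<in> Hom K (omap E j) (omap D t)" if "j \<in> Field S" for j
        using R.amap_hom[OF t(1) H(1)[OF that]] .
      fix i j assume ij: "(i, j) \<in> S"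
      then have F: "i \<in> Field S" "j \<in> Field S" by (auto simp: Field_def)
      have HE: "Compose K (H j) (amap E (i, j)) \<in> Hom K (omap E i) (omap D s)"
        using comp_in[OF S.amap_in[OF ij] H(1)[OF F(2)]] .
      have "Compose K (?H j) (amap E (i, j)) =
          Compose K (amap D (s, t)) (Compose K (H j) (amap E (i, j)))"
        using assoc[OF S.amap_in[OF ij] H(1)[OF F(2)] R.amap_in[OF t(1)]] by simp
      also have "\<dots> = Compose K (amap D (T (i, j), t))
          (Compose K (amap D (s, T (i, j))) (Compose K (H j) (amap E (i, j))))"
        using R.amap_comp[OF T(1)[OF ij] t(2)[OF ij] HE] by simp
      also have "\<dots> = ?H i"
        using T(2)[OF ij] R.amap_comp[OF T(1)[OF ij] t(2)[OF ij] H(1)[OF F(1)]] by simp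
      finally show "Compose K (?H j) (amap E (i, j)) = ?H i" .
    qed
    then obtain g where g: "g \<in> Hom K N (omap D t)" "\<And>i. i \<in> Field S \<Longrightarrow> Compose K g (\<epsilon> i) = ?H i"
      using S.colimit_factor[OF N] by blast
    have "Compose K (\<iota> t) g = f"
    proof (rule S.colimit_joint_epi[OF N comp_in[OF g(1) \<iota>[OF tF]] f])
      fix i assume i: "i \<in> Field S"
      show "Compose K (Compose K (\<iota> t) g) (\<epsilon> i) = Compose K f (\<epsilon> i)"
        using assoc[OF \<epsilon>[OF i] g(1) \<iota>[OF tF]] g(2)[OF i]
          R.cocone_amap[OF cL t(1) H(1)[OF i]] H(2)[OF i] by simp
    qed
    then show "\<exists>j\<in>Field R. \<exists>g\<in>Hom K N (omap D j). Compose K (\<iota> j) g = f"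
      using tF g(1) by blast
  next
    fix s g g' assume s: "s \<in> Field R" and g: "g \<in> Hom K N (omap D s)" "g' \<in> Hom K N (omap D s)"
      and eq: "Compose K (\<iota> s) g = Compose K (\<iota> s) g'"
    have ge: "Compose K g (\<epsilon> i) \<in> Hom K (omap E i) (omap D s)"
      "Compose K g' (\<epsilon> i) \<in> Hom K (omap E i) (omap D s)" if i: "i \<in> Field S" for i
      using comp_in[OF \<epsilon>[OF i] g(1)] comp_in[OF \<epsilon>[OF i] g(2)] .
    \<comment> \<open>The arrows \<open>g\<close> and \<open>g'\<close> are first identified on each
      leg separately, then on all legs at a common later stage.\<close>
    have "\<exists>t. (s, t) \<in> R \<and> Compose K (amap D (s, t)) (Compose K g (\<epsilon> i)) =
        Compose K (amap D (s, t)) (Compose K g' (\<epsilon> i))" if i: "i \<in> Field S" for i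
    proof (rule hom_commutes_unique[OF hc[OF i] s ge[OF i]])
      show "Compose K (\<iota> s) (Compose K g (\<epsilon> i)) = Compose K (\<iota> s) (Compose K g' (\<epsilon> i))"
        using assoc[OF \<epsilon>[OF i] g(1) \<iota>[OF s]] assoc[OF \<epsilon>[OF i] g(2) \<iota>[OF s]] eq by simp
    qed
    then obtain T where T: "\<And>i. i \<in> Field S \<Longrightarrow> (s, T i) \<in> R"
      "\<And>i. i \<in> Field S \<Longrightarrow> Compose K (amap D (s, T i)) (Compose K g (\<epsilon> i)) =
        Compose K (amap D (s, T i)) (Compose K g' (\<epsilon> i))"
      by metis
    obtain t where t: "(s, t) \<in> R" "\<And>i. i \<in> Field S \<Longrightarrow> (T i, t) \<in> R"
      using bound[OF s S(2), of T] FieldI2[OF T(1)] by blast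
    have "Compose K (amap D (s, t)) g = Compose K (amap D (s, t)) g'"
    proof (rule S.colimit_joint_epi[OF N R.amap_hom[OF t(1) g(1)] R.amap_hom[OF t(1) g(2)]])
      fix i assume i: "i \<in> Field S"
      have "Compose K (amap D (s, t)) (Compose K g (\<epsilon> i)) =
          Compose K (amap D (s, t)) (Compose K g' (\<epsilon> i))"
        using R.amap_comp[OF T(1)[OF i] t(2)[OF i] ge(1)[OF i]]
          R.amap_comp[OF T(1)[OF i] t(2)[OF i] ge(2)[OF i]] T(2)[OF i] by simp
      then show "Compose K (Compose K (amap D (s, t)) g) (\<epsilon> i) =
          Compose K (Compose K (amap D (s, t)) g') (\<epsilon> i)"
        using assoc[OF \<epsilon>[OF i] g(1) R.amap_in[OF t(1)]]
          assoc[OF \<epsilon>[OF i] g(2) R.amap_in[OF t(1)]] by simp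
    qed
    then show "\<exists>k. (s, k) \<in> R \<and> Compose K (amap D (s, k)) g = Compose K (amap D (s, k)) g'"
      by (intro exI[of _ t] conjI t(1))
  qed
qed

section \<open>Colimits as directed colimits of subcolimits\<close>

text \<open>Transition maps and legs come from the universal properties of the subcolimits. A cocone
  on the subcolimits amounts to one on \<open>D\<close>, since the sets \<open>d p\<close> cover the
  index poset and any two lie in a third. The injective \<open>d\<close> lets points of any type
  name subsets and makes inclusion antisymmetric.\<close>

lemma colimit_of_subcolimits:
  fixes d :: "'v \<Rightarrow> 'u set" and L :: "'v \<Rightarrow> 'o"
  assumes sys: "poset_system K R D" and M: "is_colimit (poset_cat R) K D M \<iota>"
    and d: "\<And>p. p \<in> I \<Longrightarrow> d p \<subseteq> Field R" and inj: "inj_on d I"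
    and cover: "\<And>i. i \<in> Field R \<Longrightarrow> \<exists>p\<in>I. i \<in> d p"
    and dir: "\<And>p q. p \<in> I \<Longrightarrow> q \<in> I \<Longrightarrow> \<exists>r\<in>I. d p \<union> d q \<subseteq> d r"
    and L: "\<And>p. p \<in> I \<Longrightarrow> is_colimit (poset_cat (Restr R (d p))) K D (L p) (\<epsilon> p)"
    and Q: "Q = {(p, q). p \<in> I \<and> q \<in> I \<and> d p \<subseteq> d q}"
  obtains E c where "omap E = L" "is_functor (poset_cat Q) K E" "is_colimit (poset_cat Q) K E M c"
proof -
  interpret poset_system K R D by fact
  note cM = is_colimitD_cocone[OF M]
  have FQ: "Field Q = I" unfolding Q by (auto simp: Field_def)
  have poQ: "Partial_order Q"
    unfolding partial_order_on_def preorder_on_def refl_on_def FQ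
    using inj by (auto simp: Q trans_def antisym_def inj_on_def)
  have sub: "poset_system K (Restr R (d p)) D" if "p \<in> I" for p
    using restrict_system[OF d[OF that]] .
  have F: "Field (Restr R (d p)) = d p" if "p \<in> I" for p
    using Field_Restr_subset[OF po d[OF that]] .
  have cL: "L p \<in> Obj K" "\<And>i. i \<in> d p \<Longrightarrow> \<epsilon> p i \<in> Hom K (omap D i) (L p)"
    "\<And>i j. (i, j) \<in> R \<Longrightarrow> i \<in> d p \<Longrightarrow> j \<in> d p \<Longrightarrow> Compose K (\<epsilon> p j) (amap D (i, j)) = \<epsilon> p i"
    if p: "p \<in> I" for p
    using is_colimitD_cocone[OF L[OF p]] unfolding is_cocone_poset_cat_iff F[OF p] by auto
  have med: "\<exists>h. h \<in> Hom K (L p) N \<and> (\<forall>i\<in>d p. Compose K h (\<epsilon> p i) = \<nu> i)"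
    if p: "p \<in> I" and \<nu>: "is_cocone (poset_cat (Restr R (d p))) K D N \<nu>" for p N \<nu>
    using poset_system.colimit_factor[OF sub[OF p] L[OF p] \<nu>] unfolding F[OF p] by metis
  have epi: "h = h'" if p: "p \<in> I" and h: "h \<in> Hom K (L p) N" "h' \<in> Hom K (L p) N"
    "\<And>i. i \<in> d p \<Longrightarrow> Compose K h (\<epsilon> p i) = Compose K h' (\<epsilon> p i)" for p N h h'
    using poset_system.colimit_joint_epi[OF sub[OF p] L[OF p] h(1,2)] h(3) unfolding F[OF p] by blast
  have "\<exists>h. h \<in> Hom K (L p) (L q) \<and> (\<forall>i\<in>d p. Compose K h (\<epsilon> p i) = \<epsilon> q i)"
    if p: "p \<in> I" and q: "q \<in> I" and pq: "d p \<subseteq> d q" for p q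
    by (rule med[OF p]) (use cL[OF q] pq in \<open>auto simp: is_cocone_poset_cat_iff F[OF p]\<close>)
  then have "\<exists>T. \<forall>p q. (p, q) \<in> Q \<longrightarrow>
      T p q \<in> Hom K (L p) (L q) \<and> (\<forall>i\<in>d p. Compose K (T p q) (\<epsilon> p i) = \<epsilon> q i)"
    unfolding Q by (intro choice_iff[THEN iffD1] allI) auto
  then obtain T where T: "\<And>p q. (p, q) \<in> Q \<Longrightarrow> T p q \<in> Hom K (L p) (L q)"
    "\<And>p q i. (p, q) \<in> Q \<Longrightarrow> i \<in> d p \<Longrightarrow> Compose K (T p q) (\<epsilon> p i) = \<epsilon> q i"
    by blast
  have "\<exists>h. h \<in> Hom K (L p) M \<and> (\<forall>i\<in>d p. Compose K h (\<epsilon> p i) = \<iota> i)" if p: "p \<in> I" for p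
    by (rule med[OF p])
      (use cM d[OF p] in \<open>auto simp: is_cocone_poset_cat_iff F[OF p]\<close>)
  then obtain c where c: "\<And>p. p \<in> I \<Longrightarrow> c p \<in> Hom K (L p) M"
    "\<And>p i. p \<in> I \<Longrightarrow> i \<in> d p \<Longrightarrow> Compose K (c p) (\<epsilon> p i) = \<iota> i"
    by metis
  define E where "E = \<lparr>omap = L, amap = (\<lambda>(p, q). T p q)\<rparr>"
  have E [simp]: "omap E = L" "amap E (p, q) = T p q" for p q by (simp_all add: E_def)
  have QI: "p \<in> I" "q \<in> I" "d p \<subseteq> d q" if "(p, q) \<in> Q" for p q using that by (auto simp: Q)
  have funct: "is_functor (poset_cat Q) K E"
    unfolding is_functor_poset_cat_iff[OF poQ] FQ E
  proof (intro conjI ballI allI impI)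
    show "L p \<in> Obj K" if "p \<in> I" for p using cL(1)[OF that] .
    show "T p q \<in> Hom K (L p) (L q)" if "(p, q) \<in> Q" for p q using T(1)[OF that] .
    show "T p p = Ident K (L p)" if p: "p \<in> I" for p
    proof (rule epi[OF p _ Ident_in_Hom[OF cL(1)[OF p]]])
      have "(p, p) \<in> Q" using p by (simp add: Q)
      then show "T p p \<in> Hom K (L p) (L p)"
        "\<And>i. i \<in> d p \<Longrightarrow> Compose K (T p p) (\<epsilon> p i) = Compose K (Ident K (L p)) (\<epsilon> p i)"
        using T Compose_Ident_left[OF cL(2)[OF p]] by simp_all
    qed
    fix p q r assume pq: "(p, q) \<in> Q" and qr: "(q, r) \<in> Q"
    then have pr: "(p, r) \<in> Q" by (auto simp: Q)
    show "T p r = Compose K (T q r) (T p q)"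
    proof (rule epi[OF QI(1)[OF pq] T(1)[OF pr] Compose_in_Hom[OF T(1)[OF pq] T(1)[OF qr]]])
      fix i assume i: "i \<in> d p"
      then have "i \<in> d q" using QI(3)[OF pq] by blast
      then show "Compose K (T p r) (\<epsilon> p i) = Compose K (Compose K (T q r) (T p q)) (\<epsilon> p i)"
        using Compose_assoc[OF cL(2)[OF QI(1)[OF pq] i] T(1)[OF pq] T(1)[OF qr]]
          T(2)[OF pq i] T(2)[OF qr] T(2)[OF pr i] by simp
    qed
  qed
  have cocone: "is_cocone (poset_cat Q) K E M c"
    unfolding is_cocone_poset_cat_iff FQ E
  proof (intro conjI ballI allI impI)
    show "M \<in> Obj K" using cocone_obj[OF cM] .
    show "c p \<in> Hom K (L p) M" if "p \<in> I" for p using c(1)[OF that] .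
    fix p q assume pq: "(p, q) \<in> Q"
    note p = QI(1)[OF pq] and q = QI(2)[OF pq]
    show "Compose K (c q) (T p q) = c p"
    proof (rule epi[OF p Compose_in_Hom[OF T(1)[OF pq] c(1)[OF q]] c(1)[OF p]])
      fix i assume i: "i \<in> d p"
      then have "i \<in> d q" using QI(3)[OF pq] by blast
      then show "Compose K (Compose K (c q) (T p q)) (\<epsilon> p i) = Compose K (c p) (\<epsilon> p i)"
        using Compose_assoc[OF cL(2)[OF p i] T(1)[OF pq] c(1)[OF q]]
          T(2)[OF pq i] c(2)[OF q] c(2)[OF p i] by simp
    qed
  qed
  have "\<exists>!h. h \<in> Hom K M N \<and> (\<forall>p\<in>I. Compose K h (c p) = \<nu> p)"
    if \<nu>: "is_cocone (poset_cat Q) K E N \<nu>" for N \<nu>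
  proof -
    have N: "N \<in> Obj K" and \<nu>_in: "\<And>p. p \<in> I \<Longrightarrow> \<nu> p \<in> Hom K (L p) N"
      and \<nu>_comp: "\<And>p q. (p, q) \<in> Q \<Longrightarrow> Compose K (\<nu> q) (T p q) = \<nu> p"
      using \<nu> unfolding is_cocone_poset_cat_iff FQ E by blast+
    obtain P where P: "\<And>i. i \<in> Field R \<Longrightarrow> P i \<in> I" "\<And>i. i \<in> Field R \<Longrightarrow> i \<in> d (P i)"
      using cover by metis
    have step: "Compose K (\<nu> p) (\<epsilon> p i) = Compose K (\<nu> q) (\<epsilon> q i)"
      if pq: "(p, q) \<in> Q" and i: "i \<in> d p" for p q i
      using Compose_assoc[OF cL(2)[OF QI(1)[OF pq] i] T(1)[OF pq] \<nu>_in[OF QI(2)[OF pq]]]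
        T(2)[OF pq i] \<nu>_comp[OF pq] by simp
    have indep: "Compose K (\<nu> p) (\<epsilon> p i) = Compose K (\<nu> q) (\<epsilon> q i)"
      if p: "p \<in> I" "i \<in> d p" and q: "q \<in> I" "i \<in> d q" for p q i
    proof -
      obtain r where "r \<in> I" "d p \<union> d q \<subseteq> d r" using dir[OF p(1) q(1)] by blast
      then have "(p, r) \<in> Q" "(q, r) \<in> Q" using p(1) q(1) by (auto simp: Q)
      then show ?thesis using step[OF _ p(2)] step[OF _ q(2)] by simp
    qed
    \<comment> \<open>The leg at \<open>i\<close> is read off from a chosen subcolimit over a set
      containing \<open>i\<close>; by \<open>indep\<close> every other such choice gives the same
      arrow.\<close>
    define n where "n i = Compose K (\<nu> (P i)) (\<epsilon> (P i) i)" for i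
    have n: "n i = Compose K (\<nu> p) (\<epsilon> p i)" if "p \<in> I" "i \<in> d p" for p i
      unfolding n_def using indep[OF P[of i] that] d that by blast
    have "is_cocone (poset_cat R) K D N n"
      unfolding is_cocone_poset_cat_iff
    proof (intro conjI ballI allI impI N)
      show "n i \<in> Hom K (omap D i) N" if "i \<in> Field R" for i
        unfolding n_def using Compose_in_Hom[OF cL(2)[OF P[OF that]] \<nu>_in[OF P(1)[OF that]]] .
      fix i j assume ij: "(i, j) \<in> R"
      then have "i \<in> Field R" "j \<in> Field R" by (auto simp: Field_def)
      \<comment> \<open>A set \<open>d r\<close> containing both ends of the arrow lets commutation
        be checked inside one subcolimit.\<close>
      then obtain r where r: "r \<in> I" "i \<in> d r" "j \<in> d r"
        using dir[OF P(1) P(1), of i j] P(2) by blast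
      show "Compose K (n j) (amap D (i, j)) = n i"
        using n[OF r(1,2)] n[OF r(1,3)] cL(3)[OF r(1) ij r(2,3)]
          Compose_assoc[OF amap_in[OF ij] cL(2)[OF r(1,3)] \<nu>_in[OF r(1)]] by simp
    qed
    then obtain h where h: "h \<in> Hom K M N" "\<And>i. i \<in> Field R \<Longrightarrow> Compose K h (\<iota> i) = n i"
      using colimit_factor[OF M] by blast
    have hc: "Compose K h (c p) = \<nu> p" if p: "p \<in> I" for p
    proof (rule epi[OF p Compose_in_Hom[OF c(1)[OF p] h(1)] \<nu>_in[OF p]])
      fix i assume i: "i \<in> d p"
      then have "i \<in> Field R" using d[OF p] by blast
      then show "Compose K (Compose K h (c p)) (\<epsilon> p i) = Compose K (\<nu> p) (\<epsilon> p i)"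
        using Compose_assoc[OF cL(2)[OF p i] c(1)[OF p] h(1)] c(2)[OF p i] h(2) n[OF p i] by simp
    qed
    have "h' = h" if h': "h' \<in> Hom K M N" "\<And>p. p \<in> I \<Longrightarrow> Compose K h' (c p) = \<nu> p" for h'
    proof (rule colimit_joint_epi[OF M h'(1) h(1)])
      fix i assume i: "i \<in> Field R"
      note p = P(1)[OF i] and ip = P(2)[OF i]
      show "Compose K h' (\<iota> i) = Compose K h (\<iota> i)"
        using Compose_assoc[OF cL(2)[OF p ip] c(1)[OF p] h'(1)]
          Compose_assoc[OF cL(2)[OF p ip] c(1)[OF p] h(1)] c(2)[OF p ip] h'(2)[OF p] hc[OF p] by simp
    qed
    note uniq = this
    show ?thesis
    proof (rule ex1I[of _ h])
      show "h \<in> Hom K M N \<and> (\<forall>p\<in>I. Compose K h (c p) = \<nu> p)" using h(1) hc by simp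
    qed (elim conjE, rule uniq, assumption, erule (1) bspec)
  qed
  then have "is_colimit (poset_cat Q) K E M c"
    unfolding is_colimit_def Obj_poset_cat FQ using cocone by simp
  then show ?thesis using that E(1) funct by blast
qed

text \<open>Presentability of \<open>M\<close> is used for one arrow only, its identity, along the
  system whose indices are codes of the \<open>\<mu>\<close>-directed subsets of size below
  \<open>\<theta>\<close>.\<close>

lemma presentable_retract_subcolimit:
  fixes K :: "('o, 'u) category" and \<mu> \<theta> R :: "'u rel"
  assumes univ: "universe TYPE('u)" and K: "category K" "locally_small K" "has_directed_colimits \<mu> K"
    and \<mu>: "regular_cardinal \<mu>" and \<theta>: "regular_cardinal \<theta>" and cl: "closed_cardinal \<mu> \<theta>"
    and D: "directed_system \<mu> K R D" and M: "is_colimit (poset_cat R) K D M \<iota>"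
    and pres: "presentable K \<theta> M"
  obtains A L \<epsilon> s r where "A \<subseteq> Field R" "|A| <o \<theta>"
    "is_colimit (poset_cat (Restr R A)) K D L \<epsilon>"
    "s \<in> Hom K M L" "r \<in> Hom K L M" "Compose K r s = Ident K M"
proof -
  interpret poset_system K R D using directed_system_poset_system[OF K(1) D] .
  have R: "small (Field R)" "directed \<mu> R" using D by (simp_all add: directed_system_def)
  define P where "P = {A. A \<subseteq> Field R \<and> |A| <o \<theta> \<and> directed \<mu> (Restr R A)}"
  have closure: "\<exists>A\<in>P. X \<subseteq> A" if "X \<subseteq> Field R" "|X| <o \<theta>" for X
    using directed_closure[OF \<mu> \<theta> cl R(2) that] unfolding P_def by (metis (mono_tags) mem_Collect_eq)
  obtain e :: "'u set \<Rightarrow> 'u" where e: "inj_on e (Pow (Field R))" "small (e ` Pow (Field R))"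
    using inj_on_Pow_small[OF univ R(1)] .
  have PP: "P \<subseteq> Pow (Field R)" by (auto simp: P_def)
  \<comment> \<open>\<open>I\<close> consists of the codes of the members of \<open>P\<close>, and
    \<open>d\<close> decodes them. Its smallness comes from that of the coded power set.\<close>
  define I where "I = e ` P"
  define d where "d = inv_into P e"
  have inj_e: "inj_on e P" using inj_on_subset[OF e(1) PP] .
  have dP: "d p \<in> P" if "p \<in> I" for p using that by (simp add: I_def d_def inv_into_into)
  have de: "d (e A) = A" if "A \<in> P" for A using that inj_e by (simp add: d_def)
  have dI: "\<exists>p\<in>I. d p = A" if "A \<in> P" for A using that de by (auto simp: I_def)
  have inj: "inj_on d I" unfolding I_def d_def by (rule inj_on_inv_into) simp
  have dF: "d p \<subseteq> Field R" "|d p| <o \<theta>" "directed \<mu> (Restr R (d p))" if "p \<in> I" for p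
    using dP[OF that] by (simp_all add: P_def)
  have small_sub: "small X" if "X \<subseteq> Y" "small Y" for X Y :: "'u set"
    using that(2) unfolding small_def by (rule ordLeq_ordLess_trans[OF card_of_mono1[OF that(1)]])
  define Q where "Q = {(p, q). p \<in> I \<and> q \<in> I \<and> d p \<subseteq> d q}"
  have FQ: "Field Q = I" unfolding Q_def by (auto simp: Field_def)
  have "\<exists>L \<epsilon>. is_colimit (poset_cat (Restr R (d p))) K D L \<epsilon>" if p: "p \<in> I" for p
  proof -
    have "Field (Restr R (d p)) \<subseteq> Field R" by (auto simp: Field_def)
    then have "directed_system \<mu> K (Restr R (d p)) D"
      using poset_system.diagram[OF restrict_system[OF dF(1)[OF p]]] dF(3)[OF p] small_sub R(1)
      unfolding directed_system_def by blast
    then show ?thesis using K(3) unfolding has_directed_colimits_def by simp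
  qed
  then obtain L \<epsilon> where L: "\<And>p. p \<in> I \<Longrightarrow> is_colimit (poset_cat (Restr R (d p))) K D (L p) (\<epsilon> p)"
    by metis
  have above: "\<exists>q\<in>I. X \<subseteq> d q" if "X \<subseteq> Field R" "|X| <o \<theta>" for X
    using closure[OF that] dI by metis
  have dirQ: "directed \<theta> Q"
    unfolding directed_def FQ
  proof (intro conjI allI impI)
    have "Partial_order Q"
      unfolding partial_order_on_def preorder_on_def refl_on_def FQ
      using inj by (auto simp: Q_def trans_def antisym_def inj_on_def)
    then show "partial_order_on I Q" by (simp add: FQ)
    fix X assume X: "X \<subseteq> I" "|X| <o \<theta>"
    \<comment> \<open>The union is small enough by regularity of \<open>\<theta>\<close>, but need
      not be \<open>\<mu>\<close>-directed; \<open>above\<close> encloses it in a member of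
      \<open>P\<close>.\<close>
    have "(\<Union>p\<in>X. d p) \<subseteq> Field R" "|\<Union>p\<in>X. d p| <o \<theta>"
      using dF(1) X(1) regular_UN[OF \<theta> X(2), of d] dF(2) by (blast, blast)
    then obtain b where "b \<in> I" "(\<Union>p\<in>X. d p) \<subseteq> d b" using above by metis
    then show "\<exists>b\<in>I. \<forall>x\<in>X. (x, b) \<in> Q" using X(1) unfolding Q_def by blast
  qed
  obtain E c where E: "omap E = L" "is_functor (poset_cat Q) K E" "is_colimit (poset_cat Q) K E M c"
  proof (rule colimit_of_subcolimits[OF poset_system_axioms M dF(1) inj _ _ L Q_def])
    show "\<exists>p\<in>I. i \<in> d p" if "i \<in> Field R" for i
      using above[of "{i}"] that finite_ordLess_regular[OF \<theta>, of "{i}"] by simp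
    show "\<exists>r\<in>I. d p \<union> d q \<subseteq> d r" if "p \<in> I" "q \<in> I" for p q
      using above[of "d p \<union> d q"] dF(1)[OF that(1)] dF(1)[OF that(2)]
        regular_Un[OF \<theta> dF(2)[OF that(1)] dF(2)[OF that(2)]] by simp
  qed
  have "I \<subseteq> e ` Pow (Field R)" using PP by (auto simp: I_def)
  then have "small (Field Q)" unfolding FQ using small_sub e(2) by blast
  then have "directed_system \<theta> K Q E" using dirQ E(2) by (simp add: directed_system_def)
  then have hc: "hom_commutes K M Q E M c"
    using pres E(3) unfolding presentable_iff[OF univ K(1,2) \<theta>] by simp
  have "M \<in> Obj K" using pres by (simp add: presentable_def)
  \<comment> \<open>The identity factors through the leg \<open>c p\<close>, which becomes the
    retraction \<open>r\<close>.\<close>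
  then obtain p s where p: "p \<in> I" and s: "s \<in> Hom K M (L p)" "Compose K (c p) s = Ident K M"
    using hom_commutes_factor[OF hc Ident_in_Hom] unfolding E(1) FQ by blast
  have "c p \<in> Hom K (L p) M"
    using is_colimitD_cocone[OF E(3)] p unfolding is_cocone_poset_cat_iff E(1) FQ by simp
  then show ?thesis using that[OF dF(1,2)[OF p] L[OF p] s(1) _ s(2)] by simp
qed

section \<open>Contradiction with the minimality of the rank\<close>

theorem corollary3p11:
  fixes K :: "('o, 'u) category"
    and \<mu> lam \<theta> :: "'u rel"
  assumes "universe TYPE('u)"
    and "regular_cardinal \<mu>"
    and "infinite_cardinal lam"
    and "\<mu> \<le>o lam"
    and "accessible \<mu> lam K"
    and "weakly_inaccessible \<theta>"
    and "lam \<le>o \<theta>"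
    and "closed_cardinal \<mu> \<theta>"
  shows "\<not> (\<exists>M\<in>Obj K. has_presentability_rank K M \<theta>)"
proof
  note univ = assms(1) and \<mu> = assms(2) and acc = assms(5) and weak = assms(6)
  have \<theta>: "regular_cardinal \<theta>" using weak by (simp add: weakly_inaccessible_def)
  have K: "category K" "locally_small K" "has_directed_colimits \<mu> K"
    using acc by (simp_all add: accessible_def)
  assume "\<exists>M\<in>Obj K. has_presentability_rank K M \<theta>"
  then obtain M where MO: "M \<in> Obj K" and pres: "presentable K \<theta> M"
    and least: "\<And>\<kappa>. regular_cardinal \<kappa> \<Longrightarrow> presentable K \<kappa> M \<Longrightarrow> \<theta> \<le>o \<kappa>"
    unfolding has_presentability_rank_def by blast
  obtain R D \<iota> where D: "directed_system \<mu> K R D"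
    and less: "\<And>i. i \<in> Field R \<Longrightarrow> less_presentable K lam (omap D i)"
    and M: "is_colimit (poset_cat R) K D M \<iota>"
    using acc MO unfolding accessible_def by blast
  interpret poset_system K R D using directed_system_poset_system[OF K(1) D] .
  obtain A L \<epsilon> s r where A: "A \<subseteq> Field R" "|A| <o \<theta>"
    and L: "is_colimit (poset_cat (Restr R A)) K D L \<epsilon>"
    and sr: "s \<in> Hom K M L" "r \<in> Hom K L M" "Compose K r s = Ident K M"
    using presentable_retract_subcolimit[OF univ K \<mu> \<theta> assms(8) D M pres] .
  \<comment> \<open>This is the bound in \<open>less_presentable\<close>, the maximum of
    \<open>lam\<close> and the first uncountable cardinal; it is at most \<open>\<theta>\<close>
    because \<open>\<theta>\<close> is uncountable.\<close>
  have "lam +c cardSuc natLeq \<le>o \<theta>"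
  proof (rule csum_cinfinite_bound[OF assms(7)])
    show "cardSuc natLeq \<le>o \<theta>"
      using weak regular_cardinalD(1)[OF \<theta>] cardSuc_least natLeq_Card_order
      unfolding weakly_inaccessible_def by blast
    show "Card_order lam" using assms(3) by (simp add: infinite_cardinal_def cardinal_def)
    show "Card_order (cardSuc natLeq)" using cardSuc_Card_order[OF natLeq_Card_order] .
    show "Cinfinite \<theta>" using regular_cardinalD(5)[OF \<theta>] .
  qed
  then have "\<exists>\<kappa> :: 'u rel. regular_cardinal \<kappa> \<and> \<kappa> <o \<theta> \<and> presentable K \<kappa> (omap D i)"
    if "i \<in> A" for i
    using less A(1) that ordLess_ordLeq_trans unfolding less_presentable_def by blast
  then obtain \<kappa> :: "'u \<Rightarrow> 'u rel" where \<kappa>: "\<And>i. i \<in> A \<Longrightarrow> regular_cardinal (\<kappa> i)"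
    "\<And>i. i \<in> A \<Longrightarrow> \<kappa> i <o \<theta>" "\<And>i. i \<in> A \<Longrightarrow> presentable K (\<kappa> i) (omap D i)"
    by metis
  \<comment> \<open>\<open>\<nu>\<close> dominates both the size of the diagram over
    \<open>A\<close> and the cardinals \<open>\<kappa> i\<close> of its objects, so its colimit
    \<open>L\<close>, and with it the retract \<open>M\<close>, is
    \<open>\<nu>\<close>-presentable.\<close>
  obtain \<nu> :: "'u rel" where \<nu>: "regular_cardinal \<nu>" "\<nu> <o \<theta>" "|A| <o \<nu>"
    "\<And>i. i \<in> A \<Longrightarrow> \<kappa> i \<le>o \<nu>"
    using bounded_regular_below[OF weak A(2), of \<kappa>] regular_cardinalD(1)[OF \<kappa>(1)] \<kappa>(2) by blast
  have F: "Field (Restr R A) = A" using Field_Restr_subset[OF po A(1)] .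
  have "presentable K \<nu> L"
  proof (rule presentable_colimit[OF univ K(1,2) \<nu>(1) restrict_system[OF A(1)] _ _ L])
    show "|Field (Restr R A)| <o \<nu>" using \<nu>(3) by (simp add: F)
    show "presentable K \<nu> (omap D i)" if "i \<in> Field (Restr R A)" for i
      using presentable_mono[OF \<kappa>(3) \<nu>(4)] that by (simp add: F)
  qed
  then have "presentable K \<nu> M" using presentable_retract[OF univ K(1,2) \<nu>(1) _ sr] by simp
  then have "\<theta> \<le>o \<nu>" using least \<nu>(1) by simp
  then show False using not_ordLess_ordLeq[OF \<nu>(2)] by simp
qed

end
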